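(* Let $n\ge 2$, let $\ell\in[n]$, and let $t$ be a positive integer. Then, as an identity of rational functions in the variables $\mathbf z=(z_{i,j})_{1\le i,j\le n}$, $$f(tB_n,\mathbf z)=\sum_{\sigma\in S_n}\ \sum_{T\in \mathbf{Arb}(\ell,n)} \mathbf z^{t\sigma}\prod_{e\notin E(T)}\frac{1}{1-\mathbf z^{W^{T,e}\sigma}},$$ where $\mathbf z^{t\sigma}=\prod_{k=1}^n z_{k,\sigma(k)}^t$, the inner product runs over all directed edges $e=(s,t')$ with $s\neq t'\in[n]$ that are not edges of $T$, and $W^{T,e}\sigma$ is the ordinary matrix product of $W^{T,e}$ with the permutation matrix of $\sigma$.
   Context: $B_n$ is the Birkhoff polytope: the set of real $n\times n$ nonnegative matrices with all row and column sums equal to $1$, viewed in $\mathbb R^{n^2}$; its vertices are the permutation matrices. A permutation $\sigma\in S_n$ is identified with its permutation matrix, whose $(i,\sigma(i))$ entries are $1$ and other entries $0$. For an integer $n\times n$ matrix $M=(m_{i,j})$, $\mathbf z^M=\prod_{1\le i,j\le n} z_{i,j}^{m_{i,j}}$ (a Laurent monomial). For a positive integer $t$, $f(tB_n,\mathbf z)=\sum_{M\in tB_n\cap\mathbb Z^{n^2}}\mathbf z^M$ (the generating function of nonnegative integer $n\times n$ matrices with all row and column sums equal to $t$). An $\ell$-arborescence on $[n]=\{1,\dots,n\}$ is a directed spanning tree on vertex set $[n]$ with all edges directed away from the root $\ell$; $\mathbf{Arb}(\ell,n)$ is the set of these and $E(T)$ is the set of directed edges of $T$. For a directed edge $e=(s,t')$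 ($s\ne t'$), its weight $w(e)$ is the $n\times n$ matrix with $(s,t')$-entry $1$, $(t',t')$-entry $-1$, and all other entries $0$. For $T\in\mathbf{Arb}(\ell,n)$ and a vertex $v$, $w^T(v)$ is the sum of the weights of the edges on the unique directed path in $T$ from $\ell$ to $v$ (so $w^T(\ell)=0$). For a directed edge $e=(s,t')\notin E(T)$, define $W^{T,e}=w^T(s)-w^T(t')+w(e)$, an $n\times n$ matrix with entries in $\{0,1,-1\}$ associated to the unique cycle of $T+e$. *)

theory Defs
  imports
    Complex_Main
    "HOL-Library.Poly_Mapping"
    "HOL-Library.Product_Lexorder"
    "HOL-Computational_Algebra.Fraction_Field"
    "HOL-Combinatorics.Permutations"
    "Jordan_Normal_Form.Matrix"
    "Graph_Theory.Graph_Theory"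
begin

text \<open>Throughout, the index set \<open>[n]\<close> is \<open>{0..<n}\<close>, matching the
  indexing of the matrices of \<^theory>\<open>Jordan_Normal_Form.Matrix\<close>.\<close>

section \<open>Rational functions and generating functions\<close>

text \<open>The fraction field of the polynomial ring over \<open>'a\<close> in the variables \<open>z\<^sub>i\<^sub>j\<close>, where
  \<open>(i, j)\<close> ranges over all pairs of naturals; an identity about \<open>n \<times> n\<close> matrices only
  involves the variables with \<open>i, j < n\<close>. (The lexicographic order on pairs is needed
  only to make the polynomial ring an instance of \<^class>\<open>idom\<close>.)\<close>

type_synonym 'a ratfun = "((nat \<times> nat \<Rightarrow>\<^sub>0 nat) \<Rightarrow>\<^sub>0 'a) fract"

definition zvar :: "nat \<Rightarrow> nat \<Rightarrow> ('a :: idom) ratfun" where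
  "zvar i j = Fraction_Field.Fract (Poly_Mapping.single (Poly_Mapping.single (i, j) 1) 1) 1"

definition zmonom :: "int mat \<Rightarrow> ('a :: idom) ratfun" where
  "zmonom M = (\<Prod>i<dim_row M. \<Prod>j<dim_col M. zvar i j powi (M $$ (i, j)))"

definition birkhoff :: "nat \<Rightarrow> real mat set" where
  "birkhoff n = {A \<in> carrier_mat n n.
     (\<forall>i<n. \<forall>j<n. 0 \<le> A $$ (i, j)) \<and>
     (\<forall>i<n. (\<Sum>j<n. A $$ (i, j)) = 1) \<and>
     (\<forall>j<n. (\<Sum>i<n. A $$ (i, j)) = 1)}"

definition dilate :: "nat \<Rightarrow> real mat set \<Rightarrow> real mat set" where
  "dilate t P = (\<lambda>A. real t \<cdot>\<^sub>m A) ` P"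

text \<open>Meaningful for bounded \<open>P\<close>, where the sum is finite.\<close>

definition genfun :: "real mat set \<Rightarrow> ('a :: idom) ratfun" where
  "genfun P = (\<Sum>M \<in> {M :: int mat. map_mat real_of_int M \<in> P}. zmonom M)"

definition perm_mat :: "nat \<Rightarrow> (nat \<Rightarrow> nat) \<Rightarrow> int mat" where
  "perm_mat n \<sigma> = mat n n (\<lambda>(i, j). if j = \<sigma> i then 1 else 0)"

section \<open>Arborescences\<close>

definition all_edges :: "nat \<Rightarrow> (nat \<times> nat) set" where
  "all_edges n = {(s, u). s < n \<and> u < n \<and> s \<noteq> u}"

text \<open>A directed spanning tree is a directed graph whose underlying undirected graph is a
  tree. The library predicate \<^const>\<open>tree\<close> only excludes directed cycles, hence it is not
  used here. Undirected cycles appear as directed cycles of length at least 3 of the symmetric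
  closure, whose 2-cycles merely traverse one edge back and forth; \<open>asym\<close> excludes pairs of
  antiparallel edges.\<close>

definition directed_spanning_tree :: "nat \<Rightarrow> nat pair_pre_digraph \<Rightarrow> bool" where
  "directed_spanning_tree n T \<longleftrightarrow>
     pverts T = {0..<n} \<and> parcs T \<subseteq> all_edges n \<and> asym (parcs T) \<and>
     connected (with_proj T) \<and>
     \<not> (\<exists>p. pre_digraph.cycle (with_proj (mk_symmetric (with_proj T))) p \<and> 3 \<le> length p)"

text \<open>An edge \<open>(s, u)\<close> is directed away from the root \<open>l\<close> if the path from \<open>l\<close> to \<open>u\<close> in
  the underlying undirected tree ends by traversing the edge from \<open>s\<close> to \<open>u\<close>.\<close>

definition arborescences :: "nat \<Rightarrow> nat \<Rightarrow> nat pair_pre_digraph set" where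
  "arborescences l n = {T. directed_spanning_tree n T \<and>
     (\<forall>(s, u) \<in> parcs T. \<exists>p.
        pre_digraph.apath (with_proj (mk_symmetric (with_proj T))) l (p @ [(s, u)]) u)}"

definition edge_weight :: "nat \<Rightarrow> nat \<times> nat \<Rightarrow> int mat" where
  "edge_weight n e = mat n n (\<lambda>(i, j).
     if (i, j) = (fst e, snd e) then 1 else if (i, j) = (snd e, snd e) then -1 else 0)"

definition root_path :: "nat pair_pre_digraph \<Rightarrow> nat \<Rightarrow> nat \<Rightarrow> (nat \<times> nat) list" where
  "root_path T l v = (THE p. pre_digraph.apath (with_proj T) l p v)"

definition vertex_weight :: "nat \<Rightarrow> nat \<Rightarrow> nat pair_pre_digraph \<Rightarrow> nat \<Rightarrow> int mat" where
  "vertex_weight n l T v = foldr (\<lambda>e A. edge_weight n e + A) (root_path T l v) (0\<^sub>m n n)"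

definition cycle_weight :: "nat \<Rightarrow> nat \<Rightarrow> nat pair_pre_digraph \<Rightarrow> nat \<times> nat \<Rightarrow> int mat" where
  "cycle_weight n l T e =
     vertex_weight n l T (fst e) - vertex_weight n l T (snd e) + edge_weight n e"

end

theory Submission
  imports Defs
begin

text \<open>A pair of a permutation \<open>\<sigma>\<close> and an arborescence \<open>T\<close> is a basis of the transportation
  polytope obtained from \<open>tB\<^sub>n\<close> by perturbing the margins so that it becomes simple: the basic
  positions are \<open>(u, \<sigma> u)\<close> for all vertices \<open>u\<close> and \<open>(s, \<sigma> u)\<close> for the edges \<open>(s, u)\<close> of \<open>T\<close>, and
  the matrices \<open>W\<^sup>T\<^sup>,\<^sup>e \<sigma>\<close> are the edge directions at the corresponding vertex.

  Expand each geometric series in the direction in which a fixed generic cost vector increases. The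
  coefficient of \<open>z\<^sup>M\<close> in the right-hand side is then a signed count of bases: a basis counts, up to
  sign, if for each nonbasic position the sign of the reduced cost agrees with the sign of the entry
  of \<open>M\<close>. If the cost of a position is varied, this count does not change: at a wall, the bases with
  a vanishing reduced cost come in pairs related by a pivot, and the sum of
  the two contributions is the same on both sides of the wall. If \<open>M\<close> has a negative entry, making that position very expensive kills all
  contributions, so the count is 0. If \<open>M\<close> is nonnegative, only the optimal basis counts, so the
  count is 1. Hence the expansion is the generating function.\<close>

text \<open>The obstacle is degeneracy: a vertex of \<open>tB_n\<close> carries one basis for each
  arborescence, so several positions may tie for leaving and pivots could not be paired. The margins
  are perturbed only to prove that pivots are unique and that at most one basis is optimal; the
  signed count itself uses the original margins and an arbitrary integer matrix \<open>M\<close>.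
  Only the cost of one position moves, so the reduced costs are affine in one real parameter. A cost
  vector without small integer relations ensures that at each wall a singular basis has exactly one
  vanishing reduced cost. Two-sided series form a module with torsion: the sum of \<open>w^k\<close>
  over all integers \<open>k\<close> is killed by \<open>1 - w\<close>. Hence a series cannot be
  identified with a rational function; the two are compared after multiplication by factors
  \<open>1 - z^W\<close>, and the outcome is forced once the series has finite support.\<close>

section \<open>Rooted trees as parent functions\<close>

text \<open>The root is its own parent, so that every vertex of \<open>[n]\<close> has a parent.\<close>

definition parent_funs :: "nat \<Rightarrow> nat \<Rightarrow> (nat \<Rightarrow> nat) set" where
  "parent_funs n l = {p. p l = l \<and> (\<forall>x<n. p x < n \<and> (\<exists>k. (p ^^ k) x = l)) \<and> (\<forall>x\<ge>n. p x = x)}"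

definition anc :: "(nat \<Rightarrow> nat) \<Rightarrow> nat \<Rightarrow> nat \<Rightarrow> bool" where
  "anc p j v \<longleftrightarrow> (\<exists>k. (p ^^ k) v = j)"

definition depth :: "(nat \<Rightarrow> nat) \<Rightarrow> nat \<Rightarrow> nat \<Rightarrow> nat" where
  "depth p l v = (LEAST k. (p ^^ k) v = l)"

lemma anc_refl [simp]: "anc p v v"
  unfolding anc_def by (rule exI[of _ 0]) simp

lemma anc_step: "anc p j (p v) \<Longrightarrow> anc p j v"
  unfolding anc_def by (metis funpow_Suc_right o_apply)

lemma anc_cases: "anc p j v \<longleftrightarrow> j = v \<or> anc p j (p v)"
proof
  assume "anc p j v"
  then obtain k where k: "(p ^^ k) v = j" unfolding anc_def by blast
  show "j = v \<or> anc p j (p v)"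
  proof (cases k)
    case 0
    then show ?thesis using k by simp
  next
    case (Suc k')
    then show ?thesis using k unfolding anc_def by (metis funpow_Suc_right o_apply)
  qed
qed (auto intro: anc_step)

lemma anc_parent: "anc p (p v) v"
  by (simp add: anc_step)

lemma anc_trans: "anc p i j \<Longrightarrow> anc p j v \<Longrightarrow> anc p i v"
  unfolding anc_def by (metis funpow_add o_apply)

lemma finite_parent_funs: "finite (parent_funs n l)"
proof -
  have "parent_funs n l \<subseteq> (\<lambda>f x. if x < n then f x else x) ` ({..<n} \<rightarrow>\<^sub>E {..<n})"
  proof
    fix p assume p: "p \<in> parent_funs n l"
    have "p = (\<lambda>x. if x < n then restrict p {..<n} x else x)"
      using p by (auto simp: parent_funs_def)
    moreover have "restrict p {..<n} \<in> {..<n} \<rightarrow>\<^sub>E {..<n}"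
      using p by (auto simp: parent_funs_def)
    ultimately show "p \<in> (\<lambda>f x. if x < n then f x else x) ` ({..<n} \<rightarrow>\<^sub>E {..<n})"
      by blast
  qed
  then show ?thesis
    by (rule finite_subset) (simp add: finite_PiE)
qed

locale rooted =
  fixes n l :: nat and p :: "nat \<Rightarrow> nat"
  assumes root: "l < n" and parent: "p \<in> parent_funs n l"
begin

lemma parent_root [simp]: "p l = l"
  and parent_less: "x < n \<Longrightarrow> p x < n"
  and anc_root: "x < n \<Longrightarrow> anc p l x"
  and parent_outside: "n \<le> x \<Longrightarrow> p x = x"
  using parent unfolding parent_funs_def anc_def by auto

lemma funpow_parent_root [simp]: "(p ^^ k) l = l"
  by (induction k) auto

lemma funpow_parent_less: "x < n \<Longrightarrow> (p ^^ k) x < n"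
  by (induction k) (auto simp: parent_less)

lemma anc_less: "anc p j v \<Longrightarrow> v < n \<Longrightarrow> j < n"
  unfolding anc_def using funpow_parent_less by blast

lemma anc_of_root: "anc p j l \<longleftrightarrow> j = l"
  unfolding anc_def by auto

lemma depth_root [simp]: "depth p l l = 0"
  unfolding depth_def by (rule Least_eq_0) simp

lemma funpow_depth: "x < n \<Longrightarrow> (p ^^ depth p l x) x = l"
  unfolding depth_def using anc_root[of x] unfolding anc_def by (metis (mono_tags, lifting) LeastI)

lemma depth_parent: 
  assumes "x < n" "x \<noteq> l"
  shows "depth p l x = Suc (depth p l (p x))"
proof -
  obtain k where "(p ^^ k) x = l" using anc_root[OF assms(1)] unfolding anc_def by auto
  then show ?thesis
    unfolding depth_def using Least_Suc[of "\<lambda>k. (p ^^ k) x = l" k] assms(2)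
    by (simp add: funpow_swap1)
qed

lemma depth_induct [consumes 1, case_names base step]:
  assumes "x < n" "P l" "\<And>x. x < n \<Longrightarrow> x \<noteq> l \<Longrightarrow> P (p x) \<Longrightarrow> P x"
  shows "P x"
  using assms(1)
proof (induction "depth p l x" arbitrary: x)
  case 0
  then have "x = l" using funpow_depth[of x] by simp
  then show ?case using assms(2) by simp
next
  case (Suc d)
  then have "x \<noteq> l" by auto
  then show ?case using Suc assms(3) depth_parent parent_less by auto
qed

lemma depth_anc_less:
  assumes "anc p j v" "v < n" "j \<noteq> v"
  shows "depth p l j < depth p l v"
  using assms(2,1,3)
proof (induction rule: depth_induct)
  case base
  then show ?case by (simp add: anc_of_root)
next
  case (step x)
  then have "anc p j (p x)" using anc_cases by blast
  then show ?case using step depth_parent[of x] by (cases "j = p x") auto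
qed

lemma anc_antisym: "anc p i j \<Longrightarrow> anc p j i \<Longrightarrow> j < n \<Longrightarrow> i = j"
  using depth_anc_less anc_less by (metis less_asym)

lemma parent_neq: "x < n \<Longrightarrow> x \<noteq> l \<Longrightarrow> p x \<noteq> x"
  using depth_parent by force

lemma parent_neq_self_iff: "x < n \<Longrightarrow> p x = x \<longleftrightarrow> x = l"
  using parent_neq by auto

lemma not_anc_parent: "x < n \<Longrightarrow> x \<noteq> l \<Longrightarrow> \<not> anc p x (p x)"
  using anc_antisym[of "p x" x] anc_parent parent_neq by blast

lemma anc_linear:
  assumes "anc p i v" "anc p j v"
  shows "anc p i j \<or> anc p j i"
proof -
  obtain a b where ab: "(p ^^ a) v = i" "(p ^^ b) v = j" using assms unfolding anc_def by blast
  show ?thesis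
  proof (cases "a \<le> b")
    case True
    then have "(p ^^ (b - a)) i = j" using ab by (metis funpow_add le_add_diff_inverse2 o_apply)
    then show ?thesis unfolding anc_def by blast
  next
    case False
    then have "(p ^^ (a - b)) j = i" using ab by (metis funpow_add le_add_diff_inverse2 nat_le_linear o_apply)
    then show ?thesis unfolding anc_def by blast
  qed
qed

lemma anc_sibling_eq:
  assumes "anc p i v" "anc p j v" "p i = p j" "i \<noteq> l" "j \<noteq> l" "v < n"
  shows "i = j"
proof -
  have "depth p l i = depth p l j" using assms depth_parent anc_less by metis
  moreover have "i < n" "j < n" using assms anc_less by auto
  ultimately show ?thesis using anc_linear[OF assms(1,2)] depth_anc_less by fastforce
qed

end

section \<open>Bases and their edge directions\<close>

text \<open>Signs are free: these are the integer points of an affine space. Entries outside the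
  square are 0 to make equality of matrices equality of functions.\<close>

definition lat :: "nat \<Rightarrow> (nat \<Rightarrow> int) \<Rightarrow> (nat \<Rightarrow> int) \<Rightarrow> (nat \<times> nat \<Rightarrow> int) set" where
  "lat n r c = {M. (\<forall>i k. \<not> (i < n \<and> k < n) \<longrightarrow> M (i, k) = 0) \<and>
     (\<forall>i<n. (\<Sum>k<n. M (i, k)) = r i) \<and> (\<forall>k<n. (\<Sum>i<n. M (i, k)) = c k)}"

text \<open>A closed form of \<open>w^T(v)\<close>: column \<open>j\<close> holds the weight of the
  edge from \<open>p j\<close> to \<open>j\<close> if that edge lies on the path to
  \<open>v\<close>. At the root the two indicators cancel because \<open>p l = l\<close>.\<close>

definition path_wt :: "(nat \<Rightarrow> nat) \<Rightarrow> nat \<Rightarrow> nat \<times> nat \<Rightarrow> int" where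
  "path_wt p v = (\<lambda>(i, j). of_bool (anc p j v) * (of_bool (i = p j) - of_bool (i = j)))"

definition cycle_wt :: "(nat \<Rightarrow> nat) \<Rightarrow> nat \<times> nat \<Rightarrow> nat \<times> nat \<Rightarrow> int" where
  "cycle_wt p = (\<lambda>(s, u) (i, j). path_wt p s (i, j) - path_wt p u (i, j) +
     of_bool (j = u) * (of_bool (i = s) - of_bool (i = j)))"

type_synonym basis = "(nat \<Rightarrow> nat) \<times> (nat \<Rightarrow> nat)"

text \<open>A basis is a pair \<open>(\<tau>, p)\<close>, where \<open>\<tau>\<close> is the inverse of the permutation \<open>\<sigma>\<close> of the
  theorem and \<open>p\<close> is the parent function of the arborescence \<open>T\<close>. The edge \<open>(s, u)\<close> corresponds
  to the matrix position \<open>(s, \<sigma> u)\<close>.\<close>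

definition bases :: "nat \<Rightarrow> nat \<Rightarrow> basis set" where
  "bases n l = {\<tau>. \<tau> permutes {..<n}} \<times> parent_funs n l"

text \<open>In the column with \<open>\<tau> k = l\<close> both alternatives coincide, so a basis
  has \<open>2 * n - 1\<close> basic positions. As edges between rows and columns they form a
  spanning tree of the complete bipartite graph.\<close>

definition basic :: "nat \<Rightarrow> basis \<Rightarrow> (nat \<times> nat) set" where
  "basic n = (\<lambda>(\<tau>, p). {(i, k). i < n \<and> k < n \<and> (i = \<tau> k \<or> i = p (\<tau> k))})"

definition nonbasic :: "nat \<Rightarrow> basis \<Rightarrow> (nat \<times> nat) set" where
  "nonbasic n B = {..<n} \<times> {..<n} - basic n B"

definition perm_pt :: "nat \<Rightarrow> basis \<Rightarrow> nat \<times> nat \<Rightarrow> int" where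
  "perm_pt n = (\<lambda>(\<tau>, p) (i, k). of_bool (i < n \<and> k < n \<and> i = \<tau> k))"

text \<open>This is \<open>W^{T,e} \<sigma>\<close> for the edge \<open>e = (s, \<tau> m)\<close>:
  the product with the permutation matrix puts column \<open>\<tau> k\<close> of the left factor at
  position \<open>k\<close>.\<close>

definition dir :: "basis \<Rightarrow> nat \<times> nat \<Rightarrow> nat \<times> nat \<Rightarrow> int" where
  "dir = (\<lambda>(\<tau>, p) (s, m) (i, k). cycle_wt p (s, \<tau> m) (i, \<tau> k))"

lemma mem_basic: "(i, k) \<in> basic n (\<tau>, p) \<longleftrightarrow> i < n \<and> k < n \<and> (i = \<tau> k \<or> i = p (\<tau> k))"
  by (simp add: basic_def)

lemma mem_nonbasic:
  "(i, k) \<in> nonbasic n (\<tau>, p) \<longleftrightarrow> i < n \<and> k < n \<and> i \<noteq> \<tau> k \<and> i \<noteq> p (\<tau> k)"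
  by (auto simp: nonbasic_def basic_def)

lemma finite_nonbasic [simp]: "finite (nonbasic n B)"
  by (simp add: nonbasic_def)

lemma finite_bases: "finite (bases n l)"
  unfolding bases_def by (intro finite_cartesian_product finite_parent_funs finite_permutations) simp

lemma lat_outside: "M \<in> lat n r c \<Longrightarrow> \<not> (i < n \<and> k < n) \<Longrightarrow> M (i, k) = 0"
  by (simp add: lat_def)

lemma lat_diff:
  "M \<in> lat n r c \<Longrightarrow> N \<in> lat n r' c' \<Longrightarrow>
    (\<lambda>x. M x - N x) \<in> lat n (\<lambda>i. r i - r' i) (\<lambda>k. c k - c' k)"
  by (auto simp: lat_def sum_subtractf)

lemma lat_add:
  "M \<in> lat n r c \<Longrightarrow> N \<in> lat n r' c' \<Longrightarrow>
    (\<lambda>x. M x + N x) \<in> lat n (\<lambda>i. r i + r' i) (\<lambda>k. c k + c' k)"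
  by (auto simp: lat_def sum.distrib)

lemma lat_scale: "M \<in> lat n r c \<Longrightarrow> (\<lambda>x. a * M x) \<in> lat n (\<lambda>i. a * r i) (\<lambda>k. a * c k)"
  by (auto simp: lat_def simp flip: sum_distrib_left)

lemma lat_sum:
  assumes "finite A" "\<And>a. a \<in> A \<Longrightarrow> M a \<in> lat n (r a) (c a)"
  shows "(\<lambda>x. \<Sum>a\<in>A. M a x) \<in> lat n (\<lambda>i. \<Sum>a\<in>A. r a i) (\<lambda>k. \<Sum>a\<in>A. c a k)"
  using assms
proof (induction A rule: finite_induct)
  case empty
  then show ?case by (simp add: lat_def)
next
  case (insert a A)
  then show ?case using lat_add[of "M a"] by simp
qed

lemma sum_permutes:
  fixes f :: "nat \<Rightarrow> 'b :: comm_monoid_add"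
  assumes "\<tau> permutes {..<n}"
  shows "(\<Sum>k<n. f (\<tau> k)) = (\<Sum>j<n. f j)"
  using sum.permute[OF assms, of f] by (simp add: o_def)

lemma permutes_less_iff: "\<tau> permutes {..<n} \<Longrightarrow> \<tau> k < n \<longleftrightarrow> k < n"
  using permutes_in_image[of \<tau> "{..<n}" k] by simp

context rooted
begin

lemma path_wt_step:
  assumes "x < n" "x \<noteq> l"
  shows "path_wt p x (i, j) = path_wt p (p x) (i, j) + of_bool (j = x) * (of_bool (i = p j) - of_bool (i = j))"
  using anc_cases[of p j x] not_anc_parent[OF assms] by (auto simp: path_wt_def)

lemma path_wt_root [simp]: "path_wt p l (i, j) = 0"
  by (auto simp: path_wt_def anc_of_root)

lemma path_wt_outside:
  assumes "v < n" "\<not> (i < n \<and> j < n)"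
  shows "path_wt p v (i, j) = 0"
proof (cases "j < n")
  case True
  then show ?thesis using assms parent_less[OF True] by (auto simp: path_wt_def)
next
  case False
  then show ?thesis using assms anc_less by (auto simp: path_wt_def)
qed

text \<open>An edge adds 1 to the row of its tail and -1 to the row of its head, so the sum along
  the path from \<open>l\<close> to \<open>v\<close> telescopes.\<close>

lemma path_wt_row: "v < n \<Longrightarrow> (\<Sum>j<n. path_wt p v (i, j)) = of_bool (i = l) - of_bool (i = v)"
proof (induction rule: depth_induct)
  case (step x)
  have "(\<Sum>j<n. path_wt p x (i, j)) = (\<Sum>j<n. path_wt p (p x) (i, j)) +
      (\<Sum>j<n. if j = x then of_bool (i = p x) - of_bool (i = x) else 0)"
    unfolding sum.distrib[symmetric] using step by (intro sum.cong) (auto simp: path_wt_step)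
  also have "\<dots> = of_bool (i = l) - of_bool (i = x)"
    using step by simp
  finally show ?case .
qed simp

lemma sum_of_bool_eq: "a < n \<Longrightarrow> (\<Sum>i<n. of_bool (i = a) :: int) = 1"
  by (simp add: of_bool_def)

lemma path_wt_col: "j < n \<Longrightarrow> (\<Sum>i<n. path_wt p v (i, j)) = 0"
  using parent_less[of j]
  by (simp add: path_wt_def sum_distrib_left[symmetric] sum_subtractf sum_of_bool_eq)

lemma cycle_wt_row:
  assumes "s < n" "u < n"
  shows "(\<Sum>j<n. cycle_wt p (s, u) (i, j)) = 0"
proof -
  have "(\<Sum>j<n. of_bool (j = u) * (of_bool (i = s) - of_bool (i = j))) = 
      (\<Sum>j<n. if j = u then of_bool (i = s) - of_bool (i = u) else 0 :: int)"
    by (intro sum.cong) auto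
  then show ?thesis
    using assms by (simp add: cycle_wt_def sum.distrib sum_subtractf path_wt_row)
qed

lemma cycle_wt_col:
  assumes "s < n" "u < n" "j < n"
  shows "(\<Sum>i<n. cycle_wt p (s, u) (i, j)) = 0"
  using assms
  by (simp add: cycle_wt_def sum.distrib sum_subtractf path_wt_col sum_distrib_left[symmetric] sum_of_bool_eq)

lemma cycle_wt_outside:
  assumes "s < n" "u < n" "\<not> (i < n \<and> j < n)"
  shows "cycle_wt p (s, u) (i, j) = 0"
  using assms path_wt_outside[of s i j] path_wt_outside[of u i j] by (auto simp: cycle_wt_def)

lemma cycle_wt_nonbasic:
  assumes "i \<noteq> j" "i \<noteq> p j"
  shows "cycle_wt p (s, u) (i, j) = of_bool (i = s \<and> j = u)"
  using assms by (auto simp: cycle_wt_def path_wt_def)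

lemma abs_cycle_wt_le: "\<bar>cycle_wt p (s, u) x\<bar> \<le> 3"
  by (cases x) (auto simp: cycle_wt_def path_wt_def)

end

locale rooted_perm = rooted +
  fixes \<tau> :: "nat \<Rightarrow> nat"
  assumes perm: "\<tau> permutes {..<n}"
begin

lemma perm_less: "\<tau> k < n \<longleftrightarrow> k < n"
  by (rule permutes_less_iff[OF perm])

lemma perm_eq_iff: "\<tau> j = \<tau> k \<longleftrightarrow> j = k"
  using permutes_inj[OF perm] by (auto dest: injD)

lemma dir_lat:
  assumes "e \<in> nonbasic n (\<tau>, p)"
  shows "dir (\<tau>, p) e \<in> lat n (\<lambda>_. 0) (\<lambda>_. 0)"
proof -
  obtain s m where e: "e = (s, m)" "s < n" "m < n" using assms by (cases e) (auto simp: mem_nonbasic)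
  then have "\<tau> m < n" by (simp add: perm_less)
  then show ?thesis
    using e cycle_wt_row[of s "\<tau> m"] cycle_wt_col[of s "\<tau> m"] cycle_wt_outside[of s "\<tau> m"]
      sum_permutes[OF perm, of "\<lambda>j. cycle_wt p (s, \<tau> m) (_, j)"]
    by (auto simp: lat_def dir_def perm_less)
qed

text \<open>The directions are dual to the nonbasic coordinates; together with
  \<open>lat_eq_zero\<close> this makes them a basis of the lattice of matrices with zero
  margins.\<close>

lemma dir_nonbasic:
  assumes "e \<in> nonbasic n (\<tau>, p)" "f \<in> nonbasic n (\<tau>, p)"
  shows "dir (\<tau>, p) e f = of_bool (f = e)"
  using assms by (cases e; cases f) (auto simp: dir_def mem_nonbasic cycle_wt_nonbasic perm_eq_iff)

lemma abs_dir_le: "\<bar>dir (\<tau>, p) e x\<bar> \<le> 3"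
  by (cases e; cases x) (simp add: dir_def abs_cycle_wt_le)

lemma perm_pt_lat: "perm_pt n (\<tau>, p) \<in> lat n (\<lambda>_. 1) (\<lambda>_. 1)"
proof -
  have "(\<Sum>k<n. of_bool (i = \<tau> k)) = (1 :: int)" if "i < n" for i
    using sum_permutes[OF perm, of "\<lambda>j. of_bool (i = j) :: int"] that by (simp add: of_bool_def)
  moreover have "(\<Sum>i<n. of_bool (i = \<tau> k)) = (1 :: int)" if "k < n" for k
    using that perm_less by (simp add: sum_of_bool_eq)
  ultimately show ?thesis by (auto simp: lat_def perm_pt_def)
qed

lemma perm_pt_nonbasic: "e \<in> nonbasic n (\<tau>, p) \<Longrightarrow> perm_pt n (\<tau>, p) e = 0"
  by (cases e) (auto simp: perm_pt_def mem_nonbasic)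

text \<open>Summing over the rows and over the columns that belong to the subtree of \<open>\<tau> k\<close> leaves
  the tree entry of column \<open>k\<close> as the only difference.\<close>

lemma lat_eq_zero:
  assumes M: "M \<in> lat n (\<lambda>_. 0) (\<lambda>_. 0)" and zero: "\<And>e. e \<in> nonbasic n (\<tau>, p) \<Longrightarrow> M e = 0"
  shows "M = (\<lambda>_. 0)"
proof -
  have tree: "M (p (\<tau> k), k) = 0" if k: "k < n" and "\<tau> k \<noteq> l" for k
  proof -
    define u where "u = \<tau> k"
    have u: "u < n" "u \<noteq> l" using that perm_less u_def by auto
    have eq: "M (i, j) * (of_bool (anc p u (\<tau> j)) - of_bool (anc p u i)) =
        (if j = k then if i = p u then M (p u, k) else 0 else 0)" if ij: "i < n" "j < n" for i j
    proof (cases "(i, j) \<in> nonbasic n (\<tau>, p)")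
      case True
      then have "\<not> (j = k \<and> i = p u)" by (auto simp: mem_nonbasic u_def)
      with zero[OF True] show ?thesis by (cases "j = k") simp_all
    next
      case False
      then consider "i = \<tau> j" | "i = p (\<tau> j)" using ij by (auto simp: mem_nonbasic)
      then show ?thesis
      proof cases
        case 1
        have "\<not> (j = k \<and> i = p u)" using 1 parent_neq[OF u] by (auto simp: u_def)
        with 1 show ?thesis by (cases "j = k") simp_all
      next
        case 2
        have "anc p u (\<tau> j) \<longleftrightarrow> u = \<tau> j \<or> anc p u i" using 2 anc_cases by blast
        have "u = \<tau> j \<longleftrightarrow> j = k" by (auto simp: u_def perm_eq_iff)
        with \<open>anc p u (\<tau> j) \<longleftrightarrow> _\<close> 2 show ?thesis
          using not_anc_parent[OF u] by (cases "j = k") simp_all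
      qed
    qed
    have "(\<Sum>i<n. \<Sum>j<n. M (i, j) * (of_bool (anc p u (\<tau> j)) - of_bool (anc p u i))) =
        (\<Sum>j<n. \<Sum>i<n. M (i, j) * of_bool (anc p u (\<tau> j))) - (\<Sum>i<n. \<Sum>j<n. M (i, j) * of_bool (anc p u i))"
      unfolding right_diff_distrib sum_subtractf by (subst sum.swap) (rule refl)
    also have "\<dots> = 0"
      using M by (simp add: lat_def sum_distrib_right[symmetric] del: sum_mult_of_bool_eq)
    finally have "(\<Sum>i<n. \<Sum>j<n. if j = k then if i = p u then M (p u, k) else 0 else 0) = 0"
      by (simp add: eq)
    then show ?thesis using k u parent_less[OF u(1)] by (simp add: u_def)
  qed
  have "M (i, k) = 0" if "i < n" "k < n" for i k
  proof -
    have "M (j, k) = (if j = \<tau> k then M (\<tau> k, k) else 0)" if "j < n" for j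
      using zero[of "(j, k)"] tree[of k] that \<open>k < n\<close> by (cases "\<tau> k = l") (auto simp: mem_nonbasic)
    then have "(\<Sum>j<n. M (j, k)) = (\<Sum>j<n. if j = \<tau> k then M (\<tau> k, k) else 0)" 
      by (intro sum.cong) auto
    moreover have "(\<Sum>j<n. M (j, k)) = 0" using M that by (simp add: lat_def)
    ultimately have "M (\<tau> k, k) = 0" using that perm_less by simp
    then show ?thesis
      using zero[of "(i, k)"] tree[of k] that by (cases "\<tau> k = l") (auto simp: mem_nonbasic)
  qed
  then show ?thesis using lat_outside[OF M] unfolding fun_eq_iff split_paired_All by blast
qed

lemma lat_eqI:
  assumes "M \<in> lat n r c" "N \<in> lat n r c" "\<And>e. e \<in> nonbasic n (\<tau>, p) \<Longrightarrow> M e = N e"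
  shows "M = N"
  using lat_eq_zero[of "\<lambda>x. M x - N x"] lat_diff[OF assms(1,2)] assms(3)
  by (auto simp: fun_eq_iff)

text \<open>Both sides have the same margins and agree at the nonbasic positions, which determines
  them. The entries \<open>M e\<close> thereby become the exponents in the geometric series at this
  basis.\<close>

lemma lat_expansion:
  assumes M: "M \<in> lat n (\<lambda>_. t) (\<lambda>_. t)"
  shows "M x = t * perm_pt n (\<tau>, p) x + (\<Sum>e\<in>nonbasic n (\<tau>, p). M e * dir (\<tau>, p) e x)"
proof -
  let ?N = "\<lambda>x. t * perm_pt n (\<tau>, p) x + (\<Sum>e\<in>nonbasic n (\<tau>, p). M e * dir (\<tau>, p) e x)"
  have "(\<lambda>x. \<Sum>e\<in>nonbasic n (\<tau>, p). M e * dir (\<tau>, p) e x) \<in> lat n (\<lambda>_. 0) (\<lambda>_. 0)"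
    using lat_sum[of "nonbasic n (\<tau>, p)" "\<lambda>e x. M e * dir (\<tau>, p) e x" n "\<lambda>_ _. 0" "\<lambda>_ _. 0"]
      lat_scale[OF dir_lat] by simp
  then have N: "?N \<in> lat n (\<lambda>_. t) (\<lambda>_. t)"
    using lat_add[OF lat_scale[OF perm_pt_lat, of t]] by fastforce
  have "M f = ?N f" if f: "f \<in> nonbasic n (\<tau>, p)" for f
    using f by (simp add: perm_pt_nonbasic dir_nonbasic sum.delta)
  then have "M = ?N" by (rule lat_eqI[OF M N])
  then show ?thesis by (rule fun_cong)
qed

end

section \<open>Pivots\<close>

text \<open>The point of the basis in a polytope with perturbed margins (row sums \<open>n\<close>, except for
  \<open>2 n\<close> in the root row, and column sums \<open>n + 1\<close>) that is simple: all basic entries are positive.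
  This makes the leaving position of a pivot unique.\<close>

definition pos_pt :: "nat \<Rightarrow> basis \<Rightarrow> nat \<times> nat \<Rightarrow> int" where
  "pos_pt n = (\<lambda>(\<tau>, p) (i, k). if i < n \<and> k < n
     then (int n + 1) * of_bool (i = \<tau> k) + (\<Sum>v<n. path_wt p v (i, \<tau> k)) else 0)"

text \<open>The value -1 says that \<open>f\<close> decreases while \<open>e\<close> grows, so that
  \<open>f\<close> can be the position that becomes 0. It also makes a pivot and its reverse
  traverse the same edge of the polytope.\<close>

definition pivot :: "nat \<Rightarrow> nat \<Rightarrow> basis \<Rightarrow> nat \<times> nat \<Rightarrow> basis \<Rightarrow> nat \<times> nat \<Rightarrow> bool" where
  "pivot n l B e B' f \<longleftrightarrow> B \<in> bases n l \<and> B' \<in> bases n l \<and> e \<in> nonbasic n B \<and> f \<in> basic n B \<and>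
     nonbasic n B' = insert f (nonbasic n B - {e}) \<and> dir B e f = -1"

context rooted_perm
begin

text \<open>The point is \<open>n + 1\<close> times the permutation matrix plus one unit of flow
  from the root to every vertex along the tree. The flow adds \<open>n\<close> to the root row and
  takes 1 from every row, which gives margins common to all bases.\<close>

lemma pos_pt_lat: "pos_pt n (\<tau>, p) \<in> lat n (\<lambda>i. int n * of_bool (i = l) + int n) (\<lambda>k. int n + 1)"
proof -
  have "(\<Sum>k<n. pos_pt n (\<tau>, p) (i, k)) = int n * of_bool (i = l) + int n" if i: "i < n" for i
  proof -
    have "(\<Sum>k<n. pos_pt n (\<tau>, p) (i, k)) =
        (\<Sum>k<n. (\<lambda>j. (int n + 1) * of_bool (i = j) + (\<Sum>v<n. path_wt p v (i, j))) (\<tau> k))"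
      using i by (simp add: pos_pt_def)
    also have "\<dots> = (\<Sum>j<n. (int n + 1) * of_bool (i = j) + (\<Sum>v<n. path_wt p v (i, j)))"
      by (rule sum_permutes[OF perm])
    also have "\<dots> = (int n + 1) * (\<Sum>j<n. of_bool (j = i)) + (\<Sum>v<n. \<Sum>j<n. path_wt p v (i, j))"
      unfolding sum.distrib sum_distrib_left by (subst (2) sum.swap) (simp add: eq_commute)
    also have "\<dots> = (int n + 1) * 1 + (\<Sum>v<n. of_bool (i = l) - of_bool (v = i))"
      using i by (simp add: path_wt_row sum_of_bool_eq eq_commute)
    also have "\<dots> = int n * of_bool (i = l) + int n"
      using i by (simp add: sum_subtractf sum_of_bool_eq)
    finally show ?thesis .
  qed
  moreover have "(\<Sum>i<n. pos_pt n (\<tau>, p) (i, k)) = int n + 1" if k: "k < n" for k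
  proof -
    have "(\<Sum>i<n. pos_pt n (\<tau>, p) (i, k)) =
        (int n + 1) * (\<Sum>i<n. of_bool (i = \<tau> k)) + (\<Sum>v<n. \<Sum>i<n. path_wt p v (i, \<tau> k))"
      unfolding sum_distrib_left by (subst sum.swap) (use k in \<open>simp add: pos_pt_def sum.distrib\<close>)
    also have "\<dots> = int n + 1"
      using k perm_less by (simp add: path_wt_col sum_of_bool_eq)
    finally show ?thesis .
  qed
  ultimately show ?thesis by (auto simp: lat_def pos_pt_def)
qed

lemma sum_path_wt:
  "(\<Sum>v<n. path_wt p v (i, j)) = (\<Sum>v<n. of_bool (anc p j v)) * (of_bool (i = p j) - of_bool (i = j))"
  by (simp add: path_wt_def sum_distrib_right)

lemma pos_pt_nonbasic: "e \<in> nonbasic n (\<tau>, p) \<Longrightarrow> pos_pt n (\<tau>, p) e = 0"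
  unfolding pos_pt_def by (cases e) (auto simp: sum_path_wt mem_nonbasic)

text \<open>The column of a non-root vertex \<open>j\<close> contains the size \<open>D\<close> of
  the subtree of \<open>j\<close> at its tree entry and \<open>n + 1 - D\<close> at its permutation
  entry; the root column contains \<open>n + 1\<close>.\<close>

lemma pos_pt_basic:
  assumes "e \<in> basic n (\<tau>, p)"
  shows "pos_pt n (\<tau>, p) e > 0"
proof -
  obtain i k where e: "e = (i, k)" "i < n" "k < n" and ik: "i = \<tau> k \<or> i = p (\<tau> k)"
    using assms by (cases e) (auto simp: mem_basic)
  define j where "j = \<tau> k"
  have j: "j < n" using e perm_less j_def by simp
  define D :: int where "D = (\<Sum>v<n. of_bool (anc p j v))"
  have "D \<le> (\<Sum>v<n. 1)" unfolding D_def by (intro sum_mono) auto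
  moreover have "of_bool (anc p j j) \<le> D"
    unfolding D_def by (rule member_le_sum) (use j in auto)
  ultimately have D: "1 \<le> D" "D \<le> int n" by simp_all
  have "pos_pt n (\<tau>, p) e = (int n + 1) * of_bool (i = j) + D * (of_bool (i = p j) - of_bool (i = j))"
    using e by (simp add: pos_pt_def sum_path_wt j_def D_def)
  then show ?thesis
    using ik D parent_neq_self_iff[OF j] by (auto simp: j_def[symmetric])
qed

text \<open>No cycle arises if \<open>s\<close> lies outside the subtree of \<open>u\<close>: that
  subtree is hung below \<open>s\<close> instead of \<open>p u\<close>, and the permutation stays.
  Here \<open>u\<close> is not the root, which is an ancestor of every vertex.\<close>

lemma pivot_reattach:
  assumes e: "(s, k) \<in> nonbasic n (\<tau>, p)" and not_anc: "\<not> anc p (\<tau> k) s"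
  shows "\<exists>B' f. pivot n l (\<tau>, p) (s, k) B' f"
proof -
  define u where "u = \<tau> k"
  have sk: "s < n" "k < n" "s \<noteq> u" "s \<noteq> p u" using e by (auto simp: mem_nonbasic u_def)
  have u: "u < n" "u \<noteq> l" "\<not> anc p u s"
    using sk perm_less not_anc anc_root by (auto simp: u_def)
  define p' where "p' = p(u := s)"
  have p'_l: "p' l = l" using u by (simp add: p'_def)
  have reach: "anc p' l x" if "x < n" "\<not> anc p u x" for x
    using that
  proof (induction rule: depth_induct)
    case (step x)
    then have "x \<noteq> u" "\<not> anc p u (p x)" using anc_refl anc_step by metis+
    moreover from this have "p' x = p x" by (simp add: p'_def)
    ultimately show ?case using step.IH anc_step[of p' l x] by simp
  qed simp
  have "anc p' l x" if "x < n" for x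
    using that
  proof (induction rule: depth_induct)
    case (step x)
    have "p' x = (if x = u then s else p x)" by (simp add: p'_def)
    then show ?case
      using reach[of s] sk u step.IH anc_step[of p' l x] by (cases "x = u") simp_all
  qed simp
  then have "p' \<in> parent_funs n l"
    using p'_l sk u parent_less parent_outside unfolding parent_funs_def anc_def p'_def by simp
  then have B': "(\<tau>, p') \<in> bases n l" using perm by (simp add: bases_def)
  have "nonbasic n (\<tau>, p') = insert (p u, k) (nonbasic n (\<tau>, p) - {(s, k)})"
  proof -
    have "(i, j) \<in> nonbasic n (\<tau>, p') \<longleftrightarrow> (i, j) \<in> insert (p u, k) (nonbasic n (\<tau>, p) - {(s, k)})" for i j
      using sk u parent_less[OF u(1)] parent_neq[OF u(1,2)]
      by (cases "j = k") (auto simp: mem_nonbasic p'_def u_def perm_eq_iff)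
    then show ?thesis by auto
  qed
  moreover have "dir (\<tau>, p) (s, k) (p u, k) = -1"
    using sk u parent_neq[OF u(1,2)] by (simp add: dir_def cycle_wt_def path_wt_def flip: u_def)
  moreover have "(p u, k) \<in> basic n (\<tau>, p)"
    using sk parent_less[OF u(1)] by (simp add: mem_basic u_def)
  ultimately have "pivot n l (\<tau>, p) (s, k) (\<tau>, p') (p u, k)"
    unfolding pivot_def using B' e perm parent by (auto simp: bases_def)
  then show ?thesis by blast
qed

text \<open>If the entering edge \<open>(s, u)\<close> closes a directed cycle, the tree path from \<open>u\<close> to \<open>s\<close> is
  reversed and the permutation is rotated along it. If \<open>u\<close> is the root, the path starts at the
  child of the root instead, since the root row has to remain the root.\<close>

lemma pivot_rotate:
  assumes e: "(s, k) \<in> nonbasic n (\<tau>, p)" and is_anc: "anc p (\<tau> k) s"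
  shows "\<exists>B' f. pivot n l (\<tau>, p) (s, k) B' f"
proof -
  define u where "u = \<tau> k"
  have sk: "s < n" "k < n" "s \<noteq> u" "s \<noteq> p u" using e by (auto simp: mem_nonbasic u_def)
  have u: "u < n" "anc p u s" using sk perm_less is_anc by (auto simp: u_def)
  have s: "s \<noteq> l" using u sk anc_of_root by auto
  have child: "\<exists>w. p w = l \<and> w \<noteq> l \<and> anc p w x" if "x < n" "x \<noteq> l" for x
    using that
  proof (induction rule: depth_induct)
    case (step x)
    then show ?case by (cases "p x = l") (auto intro: anc_step)
  qed simp
  \<comment> \<open>The permutation entry of \<open>w\<close> will leave: \<open>w = u\<close> in
    general, but the child of the root towards \<open>s\<close> if \<open>u = l\<close>.\<close>
  obtain w where w: "w \<noteq> l" "anc p w s" and w_u: "u \<noteq> l \<Longrightarrow> w = u" and w_l: "u = l \<Longrightarrow> p w = l"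
    using child[OF sk(1) s] u by (cases "u = l") blast+
  have w_less: "w < n" using w sk anc_less by blast
  define Z where "Z = {x. anc p u x \<and> anc p x s}"
  have uZ: "u \<in> Z" and sZ: "s \<in> Z" using u by (auto simp: Z_def)
  have wZ: "w \<in> Z"
    using w w_u w_l anc_root[OF w_less] by (cases "u = l") (auto simp: Z_def)
  have Z_less: "x < n" if "x \<in> Z" for x using that sk anc_less by (auto simp: Z_def)
  have Z_root: "u = l" if "l \<in> Z" using that by (auto simp: Z_def anc_of_root)
  have Z_parent: "p x \<in> Z" "x \<noteq> l" "p x \<noteq> s" if x: "x \<in> Z" "x \<noteq> u" for x
  proof -
    show "x \<noteq> l" using x Z_root by auto
    have "anc p u (p x)" using x anc_cases[of p u x] by (auto simp: Z_def)
    moreover have "anc p (p x) s" using x anc_trans[OF anc_parent[of p x]] by (simp add: Z_def)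
    ultimately show "p x \<in> Z" by (simp add: Z_def)
    show "p x \<noteq> s" using not_anc_parent[OF Z_less[OF x(1)] \<open>x \<noteq> l\<close>] x by (auto simp: Z_def)
  qed
  have Z_inj: "x = y" if "x \<in> Z" "x \<noteq> u" "y \<in> Z" "y \<noteq> u" "p x = p y" for x y
    using anc_sibling_eq[of x s y] that Z_parent(2)[of x] Z_parent(2)[of y] sk by (simp add: Z_def)
  have Z_child_root: "u = l \<and> x = w" if "x \<in> Z" "x \<noteq> u" "p x = l" for x
  proof -
    have "u = l" using Z_parent(1)[OF that(1,2)] that(3) Z_root by simp
    then show ?thesis using Z_inj[OF that(1,2) wZ] w that w_l by auto
  qed
  \<comment> \<open>Below \<open>u\<close>, a column passes from its vertex to the parent, so its
    former tree entry becomes its permutation entry. The column of \<open>u\<close> passes to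
    \<open>s\<close>, where the entering entry lies.\<close>
  define \<rho> where "\<rho> x = (if x = u then s else if x \<in> Z then p x else x)" for x
  have "inj_on \<rho> {..<n}"
  proof (rule inj_onI)
    fix x y assume "\<rho> x = \<rho> y"
    then show "x = y"
      using Z_parent[of x] Z_parent[of y] Z_inj[of x y] sZ uZ
      by (auto simp: \<rho>_def split: if_splits)
  qed
  moreover have "\<rho> ` {..<n} \<subseteq> {..<n}"
    using sk parent_less by (auto simp: \<rho>_def)
  ultimately have "bij_betw \<rho> {..<n} {..<n}"
    by (simp add: bij_betw_def endo_inj_surj)
  then have \<rho>_perm: "\<rho> permutes {..<n}"
    by (rule bij_imp_permutes) (use u Z_less in \<open>auto simp: \<rho>_def\<close>)
  \<comment> \<open>On the path, \<open>inv_into UNIV \<rho> y\<close> is the child of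
    \<open>y\<close> towards \<open>s\<close>, which is the parent after reversal. The reversed path
    is attached at \<open>p w\<close>, the old parent of its upper end.\<close>
  define p' where "p' y = (if y = l then l else if y = s then p w else if y \<in> Z then inv_into UNIV \<rho> y else p y)" for y
  have p'_parent: "p' (p x) = (if p x = l then l else x)" if "x \<in> Z" "x \<noteq> u" for x
  proof -
    have "\<rho> x = p x" using that by (simp add: \<rho>_def)
    then have "inv_into UNIV \<rho> (p x) = x" using permutes_inverses(2)[OF \<rho>_perm, of x] by simp
    then show ?thesis using Z_parent[OF that] by (simp add: p'_def)
  qed
  have reach_above: "anc p' l x" if "x < n" "\<not> anc p w x" for x
    using that
  proof (induction rule: depth_induct)
    case (step x)
    have "x \<notin> Z"
    proof
      assume x: "x \<in> Z"
      then have "u = l" using w_u step.prems by (auto simp: Z_def)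
      moreover have "anc p x w" using anc_linear[of x s w] x w step.prems by (auto simp: Z_def)
      ultimately have "anc p x l" using w_l step.prems anc_cases[of p x w] by auto
      then show False using step.hyps by (simp add: anc_of_root)
    qed
    then have "p' x = p x" using sZ step.hyps by (auto simp: p'_def)
    moreover have "\<not> anc p w (p x)" using step.prems anc_step by blast
    ultimately show ?case using step.IH anc_step[of p' l x] by simp
  qed simp
  have reach_s: "anc p' l s"
    using reach_above[OF parent_less[OF w_less] not_anc_parent[OF w_less w(1)]] s anc_step[of p' l s]
    by (simp add: p'_def)
  have reach_path: "(p ^^ i) s \<in> Z \<Longrightarrow> anc p' l ((p ^^ i) s)" for i
  proof (induction i)
    case 0
    then show ?case using reach_s by simp
  next
    case (Suc i)
    define y where "y = (p ^^ i) s"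
    have "p y \<in> Z" using Suc.prems by (simp add: y_def)
    then have "anc p u y" using anc_step[of p u y] by (simp add: Z_def)
    moreover have "anc p y s" by (auto simp: y_def anc_def)
    ultimately have y: "y \<in> Z" by (simp add: Z_def)
    show ?case
    proof (cases "p y = l")
      case False
      then have "y \<noteq> u"
        using not_anc_parent[of u] u \<open>p y \<in> Z\<close> by (cases "u = l") (auto simp: Z_def)
      then have "p' (p y) = y" using p'_parent[OF y] False by simp
      then show ?thesis using Suc.IH y anc_step[of p' l "p y"] by (simp add: y_def)
    qed (simp add: y_def)
  qed
  have "anc p' l x" if "x < n" for x
    using that
  proof (induction rule: depth_induct)
    case (step x)
    show ?case
    proof (cases "x \<in> Z")
      case True
      then obtain i where "x = (p ^^ i) s" unfolding Z_def anc_def by auto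
      then show ?thesis using reach_path[of i] True by simp
    next
      case False
      then have "p' x = p x" using sZ step.hyps by (auto simp: p'_def)
      then show ?thesis using step.IH anc_step[of p' l x] by simp
    qed
  qed simp
  moreover have "p' y < n" if "y < n" for y
    using that root w_less parent_less permutes_less_iff[OF permutes_inv[OF \<rho>_perm]]
    by (auto simp: p'_def)
  moreover have "p' y = y" if "n \<le> y" for y
    using that root sk Z_less[of y] parent_outside by (auto simp: p'_def)
  ultimately have p'_mem: "p' \<in> parent_funs n l"
    unfolding parent_funs_def anc_def[symmetric] by (auto simp: p'_def anc_def)
  define \<tau>' where "\<tau>' = \<rho> \<circ> \<tau>"
  have B': "(\<tau>', p') \<in> bases n l"
    using p'_mem permutes_compose[OF perm \<rho>_perm] by (simp add: bases_def \<tau>'_def)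
  have swap: "(i = \<rho> x \<or> i = p' (\<rho> x)) \<longleftrightarrow> (i = s \<and> x = u) \<or> ((i = x \<or> i = p x) \<and> \<not> (i = w \<and> x = w))" 
    if "x < n" for i x
  proof -
    consider "x = u" "u \<noteq> l" | "x = u" "u = l" | "x \<in> Z" "x \<noteq> u" | "x \<notin> Z" by auto
    then show ?thesis
    proof cases
      case 1
      then show ?thesis using w_u s parent_neq[OF u(1)] by (auto simp: \<rho>_def p'_def)
    next
      case 2
      then show ?thesis using w_l w s by (auto simp: \<rho>_def p'_def)
    next
      case 3
      then show ?thesis
        using p'_parent[OF 3] Z_child_root[OF 3] w_u w_l w parent_neq[OF w_less w(1)] by (cases "p x = l") (auto simp: \<rho>_def)
    next
      case 4
      then show ?thesis using uZ wZ sZ by (auto simp: \<rho>_def p'_def)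
    qed
  qed
  define m where "m = inv_into UNIV \<tau> w"
  have m: "\<tau> m = w" "m < n"
    using permutes_inverses(1)[OF perm] permutes_less_iff[OF permutes_inv[OF perm]] w_less
    by (auto simp: m_def)
  have "nonbasic n (\<tau>', p') = insert (w, m) (nonbasic n (\<tau>, p) - {(s, k)})"
  proof -
    have "(i, j) \<in> nonbasic n (\<tau>', p') \<longleftrightarrow> (i, j) \<in> insert (w, m) (nonbasic n (\<tau>, p) - {(s, k)})" for i j
    proof (cases "i < n \<and> j < n")
      case True
      have "\<tau> j = u \<longleftrightarrow> j = k" "\<tau> j = w \<longleftrightarrow> j = m" using m perm_eq_iff by (auto simp: u_def)
      then show ?thesis
        using True swap[of "\<tau> j" i] perm_less[of j] m w_less wZ uZ sk w_u w
        by (auto simp: mem_nonbasic \<tau>'_def)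
    next
      case False
      then show ?thesis using m w_less by (auto simp: mem_nonbasic)
    qed
    then show ?thesis by auto
  qed
  moreover have "dir (\<tau>, p) (s, k) (w, m) = -1"
    using w w_u sk parent_neq[OF w_less w(1)] m anc_of_root
    by (cases "u = l") (auto simp: dir_def cycle_wt_def path_wt_def simp flip: u_def)
  moreover have "(w, m) \<in> basic n (\<tau>, p)"
    using m w_less by (simp add: mem_basic)
  ultimately have "pivot n l (\<tau>, p) (s, k) (\<tau>', p') (w, m)"
    unfolding pivot_def using B' e perm parent by (auto simp: bases_def)
  then show ?thesis by blast
qed

lemma pivot_exists:
  assumes "e \<in> nonbasic n (\<tau>, p)"
  shows "\<exists>B' f. pivot n l (\<tau>, p) e B' f"
  using assms pivot_reattach pivot_rotate by (cases e) blast

end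

section \<open>Pivots between bases: exchange formulas, symmetry and uniqueness\<close>

locale root_index =
  fixes n l :: nat
  assumes root: "l < n"
begin

lemma basis_cases:
  assumes "B \<in> bases n l"
  obtains \<tau> p where "B = (\<tau>, p)" "rooted_perm n l p \<tau>"
  using assms root unfolding bases_def rooted_perm_def rooted_def rooted_perm_axioms_def by auto

lemma dir_lat: "B \<in> bases n l \<Longrightarrow> e \<in> nonbasic n B \<Longrightarrow> dir B e \<in> lat n (\<lambda>_. 0) (\<lambda>_. 0)"
  by (elim basis_cases) (simp add: rooted_perm.dir_lat)

lemma dir_nonbasic:
  "B \<in> bases n l \<Longrightarrow> e \<in> nonbasic n B \<Longrightarrow> f \<in> nonbasic n B \<Longrightarrow> dir B e f = of_bool (f = e)"
  by (elim basis_cases) (simp add: rooted_perm.dir_nonbasic)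

lemma abs_dir_le: "B \<in> bases n l \<Longrightarrow> \<bar>dir B e x\<bar> \<le> 3"
  by (elim basis_cases) (simp add: rooted_perm.abs_dir_le)

lemma perm_pt_lat: "B \<in> bases n l \<Longrightarrow> perm_pt n B \<in> lat n (\<lambda>_. 1) (\<lambda>_. 1)"
  by (elim basis_cases) (simp add: rooted_perm.perm_pt_lat)

lemma perm_pt_nonbasic: "B \<in> bases n l \<Longrightarrow> e \<in> nonbasic n B \<Longrightarrow> perm_pt n B e = 0"
  by (elim basis_cases) (simp add: rooted_perm.perm_pt_nonbasic)

lemma pos_pt_lat:
  "B \<in> bases n l \<Longrightarrow> pos_pt n B \<in> lat n (\<lambda>i. int n * of_bool (i = l) + int n) (\<lambda>k. int n + 1)"
  by (elim basis_cases) (simp add: rooted_perm.pos_pt_lat)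

lemma pos_pt_nonbasic: "B \<in> bases n l \<Longrightarrow> e \<in> nonbasic n B \<Longrightarrow> pos_pt n B e = 0"
  by (elim basis_cases) (simp add: rooted_perm.pos_pt_nonbasic)

lemma pos_pt_basic: "B \<in> bases n l \<Longrightarrow> e \<in> basic n B \<Longrightarrow> pos_pt n B e > 0"
  by (elim basis_cases) (simp add: rooted_perm.pos_pt_basic)

lemma pos_pt_nonneg: "B \<in> bases n l \<Longrightarrow> pos_pt n B e \<ge> 0"
proof -
  assume B: "B \<in> bases n l"
  obtain i k where e: "e = (i, k)" by (cases e)
  show ?thesis
    using pos_pt_basic[OF B, of e] pos_pt_nonbasic[OF B, of e] lat_outside[OF pos_pt_lat[OF B], of i k]
    unfolding nonbasic_def e by (cases "i < n \<and> k < n"; cases "(i, k) \<in> basic n B") simp_all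
qed

lemma lat_eqI:
  "B \<in> bases n l \<Longrightarrow> M \<in> lat n r c \<Longrightarrow> N \<in> lat n r c \<Longrightarrow>
    (\<And>e. e \<in> nonbasic n B \<Longrightarrow> M e = N e) \<Longrightarrow> M = N"
  by (elim basis_cases) (rule rooted_perm.lat_eqI, auto)

lemma lat_expansion:
  "B \<in> bases n l \<Longrightarrow> M \<in> lat n (\<lambda>_. t) (\<lambda>_. t) \<Longrightarrow>
    M x = t * perm_pt n B x + (\<Sum>e\<in>nonbasic n B. M e * dir B e x)"
  by (elim basis_cases) (use rooted_perm.lat_expansion in blast)

lemma pivot_exists: "B \<in> bases n l \<Longrightarrow> e \<in> nonbasic n B \<Longrightarrow> \<exists>B' f. pivot n l B e B' f"
  by (elim basis_cases) (use rooted_perm.pivot_exists in blast)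

text \<open>The permutation matrix is the only matrix with margins 1 that vanishes at the nonbasic
  positions, so \<open>\<tau>\<close> can be read off; the second basic row of a column then gives
  the parent.\<close>

lemma bases_eqI:
  assumes B: "B \<in> bases n l" and B': "B' \<in> bases n l" and eq: "nonbasic n B = nonbasic n B'"
  shows "B = B'"
proof -
  obtain \<tau> p where Beq: "B = (\<tau>, p)" and 1: "rooted_perm n l p \<tau>" using B by (rule basis_cases)
  obtain \<tau>' p' where B'eq: "B' = (\<tau>', p')" and 2: "rooted_perm n l p' \<tau>'" using B' by (rule basis_cases)
  interpret B1: rooted_perm n l p \<tau> by (rule 1)
  interpret B2: rooted_perm n l p' \<tau>' by (rule 2)
  have "perm_pt n B = perm_pt n B'"
    by (rule lat_eqI[OF B perm_pt_lat[OF B] perm_pt_lat[OF B']])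
      (use B B' eq in \<open>simp add: perm_pt_nonbasic\<close>)
  then have pt: "perm_pt n B (\<tau> k, k) = perm_pt n B' (\<tau> k, k)" for k by simp
  have eq_less: "\<tau> k = \<tau>' k" if "k < n" for k
    using that B1.perm_less[of k] pt[of k] by (simp add: perm_pt_def Beq B'eq)
  have \<tau>: "\<tau> = \<tau>'"
  proof
    fix k
    show "\<tau> k = \<tau>' k"
      using eq_less[of k] permutes_not_in[OF B1.perm, of k] permutes_not_in[OF B2.perm, of k]
      by (cases "k < n") auto
  qed
  have "p u = p' u" for u
  proof (cases "u < n \<and> u \<noteq> l")
    case True
    define k where "k = inv_into UNIV \<tau> u"
    have k: "\<tau> k = u" using permutes_inverses(1)[OF B1.perm] by (simp add: k_def)
    have kn: "k < n" using B1.perm_less[of k] k True by simp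
    have iff: "i \<noteq> u \<and> i \<noteq> p u \<longleftrightarrow> i \<noteq> u \<and> i \<noteq> p' u" if "i < n" for i
      using eq that kn mem_nonbasic[of i k n \<tau> p] mem_nonbasic[of i k n \<tau>' p']
      by (simp add: Beq B'eq \<tau>[symmetric] k)
    then show ?thesis
      using True iff[OF B1.parent_less[of u]] B1.parent_neq[of u] by auto
  next
    case False
    then show ?thesis using B1.parent_outside B2.parent_outside by (cases "u = l") auto
  qed
  then show ?thesis using \<tau> Beq B'eq by auto
qed

lemma pivot_dir:
  assumes "pivot n l B e B' f"
  shows "dir B' f = (\<lambda>x. - dir B e x)"
proof -
  have B: "B \<in> bases n l" "B' \<in> bases n l" "e \<in> nonbasic n B" "f \<in> nonbasic n B'"
    and nb: "nonbasic n B' = insert f (nonbasic n B - {e})" and neg: "dir B e f = -1"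
    using assms by (auto simp: pivot_def)
  have "(\<lambda>x. - dir B e x) \<in> lat n (\<lambda>_. 0) (\<lambda>_. 0)"
    using lat_scale[OF dir_lat[OF B(1,3)], of "-1"] by simp
  moreover have "dir B' f x = - dir B e x" if "x \<in> nonbasic n B'" for x
    using that nb neg dir_nonbasic[OF B(2,4) that] dir_nonbasic[OF B(1,3), of x] by auto
  ultimately show ?thesis
    by (intro lat_eqI[OF B(2) dir_lat[OF B(2,4)]])
qed

lemma pivot_sym:
  assumes "pivot n l B e B' f"
  shows "pivot n l B' f B e"
proof -
  have piv: "B \<in> bases n l" "B' \<in> bases n l" "e \<in> nonbasic n B" "f \<in> basic n B" "f \<notin> nonbasic n B"
    and nb: "nonbasic n B' = insert f (nonbasic n B - {e})"
    using assms by (auto simp: pivot_def nonbasic_def)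
  have "nonbasic n B = insert e (nonbasic n B' - {f})" using nb piv by blast
  moreover have "e \<notin> nonbasic n B'" using nb piv by auto
  then have "e \<in> basic n B'" using piv(3) by (simp add: nonbasic_def)
  moreover have "dir B' f e = -1"
    using pivot_dir[OF assms] dir_nonbasic[of B e e] piv by simp
  ultimately show ?thesis using piv nb by (simp add: pivot_def)
qed

text \<open>The multiple of \<open>dir B e\<close> is the one that cancels the entry at
  \<open>f\<close>, where \<open>dir B e\<close> is -1.\<close>

lemma pivot_dir_other:
  assumes "pivot n l B e B' f" and g: "g \<in> nonbasic n B" "g \<noteq> e"
  shows "dir B' g x = dir B g x + dir B g f * dir B e x"
proof -
  have B: "B \<in> bases n l" "B' \<in> bases n l" "e \<in> nonbasic n B" 
    and nb: "nonbasic n B' = insert f (nonbasic n B - {e})" and neg: "dir B e f = -1"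
    and f: "f \<notin> nonbasic n B"
    using assms(1) by (auto simp: pivot_def nonbasic_def)
  have gB': "g \<in> nonbasic n B'" using g nb by simp
  have "(\<lambda>x. dir B g x + dir B g f * dir B e x) \<in> lat n (\<lambda>_. 0) (\<lambda>_. 0)"
    using lat_add[OF dir_lat[OF B(1) g(1)] lat_scale[OF dir_lat[OF B(1,3)]]] by simp
  moreover have "dir B' g y = dir B g y + dir B g f * dir B e y" if "y \<in> nonbasic n B'" for y
    using that nb neg f g dir_nonbasic[OF B(2) gB' that] dir_nonbasic[OF B(1) g(1), of y]
      dir_nonbasic[OF B(1,3), of y] by auto
  ultimately have "dir B' g = (\<lambda>x. dir B g x + dir B g f * dir B e x)"
    by (intro lat_eqI[OF B(2) dir_lat[OF B(2) gB']])
  then show ?thesis by (rule fun_cong)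
qed

lemma pos_pt_pivot:
  assumes "pivot n l B e B' f"
  shows "pos_pt n B' x = pos_pt n B x + pos_pt n B f * dir B e x"
proof -
  have B: "B \<in> bases n l" "B' \<in> bases n l" "e \<in> nonbasic n B"
    and nb: "nonbasic n B' = insert f (nonbasic n B - {e})" and neg: "dir B e f = -1"
    using assms by (auto simp: pivot_def)
  have "(\<lambda>x. pos_pt n B x + pos_pt n B f * dir B e x) \<in>
      lat n (\<lambda>i. int n * of_bool (i = l) + int n) (\<lambda>k. int n + 1)"
    using lat_add[OF pos_pt_lat[OF B(1)] lat_scale[OF dir_lat[OF B(1,3)]]] by simp
  moreover have "pos_pt n B' y = pos_pt n B y + pos_pt n B f * dir B e y" if "y \<in> nonbasic n B'" for y
    using that nb neg pos_pt_nonbasic[OF B(2) that] pos_pt_nonbasic[OF B(1), of y]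
      dir_nonbasic[OF B(1,3), of y] by auto
  ultimately have "pos_pt n B' = (\<lambda>x. pos_pt n B x + pos_pt n B f * dir B e x)"
    by (intro lat_eqI[OF B(2) pos_pt_lat[OF B(2)]])
  then show ?thesis by (rule fun_cong)
qed

text \<open>After the pivot that lets \<open>g\<close> leave, a competing \<open>h\<close> is basic,
  so its new entry \<open>pos_pt n B h - pos_pt n B g\<close> is positive. The same holds with the
  roles exchanged, a contradiction: positive basic entries rule out ties.\<close>

lemma pivot_unique:
  assumes 1: "pivot n l B e B1 f1" and 2: "pivot n l B e B2 f2"
  shows "B1 = B2" "f1 = f2"
proof -
  have less: "pos_pt n B g < pos_pt n B h"
    if piv: "pivot n l B e C g" "pivot n l B e D h" "g \<noteq> h" for C D g h
  proof -
    have "h \<notin> nonbasic n C" "h \<in> {..<n} \<times> {..<n}"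
      using piv unfolding pivot_def by (auto simp: nonbasic_def basic_def)
    then have "h \<in> basic n C" by (simp add: nonbasic_def)
    then have "0 < pos_pt n C h" using piv by (intro pos_pt_basic) (auto simp: pivot_def)
    also have "\<dots> = pos_pt n B h - pos_pt n B g"
      using pos_pt_pivot[OF piv(1), of h] piv(2) by (simp add: pivot_def)
    finally show ?thesis by simp
  qed
  show "f1 = f2" using less[OF 1 2] less[OF 2 1] by force
  then show "B1 = B2" using 1 2 by (intro bases_eqI) (auto simp: pivot_def)
qed

end

section \<open>The signed count of bases\<close>

definition cost :: "nat \<Rightarrow> (nat \<times> nat \<Rightarrow> real) \<Rightarrow> (nat \<times> nat \<Rightarrow> int) \<Rightarrow> real" where
  "cost n c W = (\<Sum>x\<in>{..<n} \<times> {..<n}. c x * of_int (W x))"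

text \<open>The coefficients of the expansion of \<open>1 / (1 - w)\<close> in powers of \<open>w\<close> if \<open>r > 0\<close>,
  and in powers of \<open>1 / w\<close> otherwise.\<close>

definition geo_coeff :: "real \<Rightarrow> int \<Rightarrow> int" where
  "geo_coeff r m = (if r > 0 then of_bool (m \<ge> 0) else - of_bool (m < 0))"

text \<open>For \<open>M\<close> with all margins \<open>t\<close>, this is the coefficient of
  \<open>z^M\<close> in the expanded summand of \<open>B\<close>: by \<open>lat_expansion\<close>,
  \<open>M e\<close> is the exponent taken from the series of the nonbasic position
  \<open>e\<close>.\<close>

definition contrib :: "nat \<Rightarrow> (nat \<times> nat \<Rightarrow> real) \<Rightarrow> (nat \<times> nat \<Rightarrow> int) \<Rightarrow> basis \<Rightarrow> int" where
  "contrib n c M B = (\<Prod>e\<in>nonbasic n B. geo_coeff (cost n c (dir B e)) (M e))"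

text \<open>The bound \<open>18 = 2 * 3 * 3\<close> admits the combination of two edge directions, whose entries
  are at most 3, with coefficients that are such entries themselves.\<close>

definition generic :: "nat \<Rightarrow> (nat \<times> nat \<Rightarrow> real) \<Rightarrow> bool" where
  "generic n c \<longleftrightarrow> (\<forall>D. (\<forall>x. \<bar>D x\<bar> \<le> 18) \<and> cost n c D = 0 \<longrightarrow> (\<forall>x\<in>{..<n} \<times> {..<n}. D x = 0))"

lemma cost_lincomb: "cost n c (\<lambda>x. a * V x + b * W x) = of_int a * cost n c V + of_int b * cost n c W"
  by (simp add: cost_def sum_distrib_left sum.distrib algebra_simps)

lemma cost_uminus: "cost n c (\<lambda>x. - W x) = - cost n c W"
  by (simp add: cost_def sum_negf)

lemma cost_sum:
  "cost n c (\<lambda>x. \<Sum>a\<in>A. m a * W a x) = (\<Sum>a\<in>A. of_int (m a) * cost n c (W a))"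
  unfolding cost_def sum_distrib_left of_int_sum
  by (subst sum.swap) (simp add: sum_distrib_left algebra_simps)

lemma cost_upd:
  assumes "x \<in> {..<n} \<times> {..<n}"
  shows "cost n (c(x := c x + s)) W = cost n c W + s * of_int (W x)"
proof -
  have "cost n (c(x := c x + s)) W = (\<Sum>y\<in>{..<n} \<times> {..<n}. c y * of_int (W y) + (if y = x then s * of_int (W x) else 0))"
    unfolding cost_def by (intro sum.cong) (auto simp: algebra_simps)
  also have "\<dots> = cost n c W + s * of_int (W x)"
    using assms by (simp add: cost_def sum.distrib)
  finally show ?thesis .
qed

text \<open>The value does not depend on the sign of \<open>r\<close>. This is why the joint
  contribution of a pivot pair survives the crossing of a wall, where the reduced costs
  \<open>r\<close> and \<open>- r\<close> change sign together.\<close>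

lemma geo_coeff_pair: "r \<noteq> 0 \<Longrightarrow> geo_coeff r m + geo_coeff (- r) m' = of_bool (m \<ge> 0) - of_bool (m' < 0)"
  by (auto simp: geo_coeff_def)

lemma eventually_geo_coeff:
  assumes "a + \<tau> * b \<noteq> 0"
  shows "\<forall>\<^sub>F s in at \<tau>. geo_coeff (a + s * b) m = geo_coeff (a + \<tau> * b) m"
proof -
  have lim: "((\<lambda>s. a + s * b) \<longlongrightarrow> a + \<tau> * b) (at \<tau>)" by (intro tendsto_intros)
  show ?thesis
  proof (cases "a + \<tau> * b > 0")
    case True
    show ?thesis
      by (rule eventually_mono[OF order_tendstoD(1)[OF lim True]]) (use True in \<open>simp add: geo_coeff_def\<close>)
  next
    case False
    then have neg: "a + \<tau> * b < 0" using assms by simp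
    show ?thesis
      by (rule eventually_mono[OF order_tendstoD(2)[OF lim neg]]) (use neg in \<open>simp add: geo_coeff_def\<close>)
  qed
qed

text \<open>The value of \<open>h\<close> at a wall itself is arbitrary, so only punctured
  neighbourhoods count. The limit values \<open>H x\<close> form a locally constant function on the
  connected real line, and it is known near infinity.\<close>

lemma eventually_const_propagate:
  fixes h :: "real \<Rightarrow> 'b"
  assumes loc: "\<And>x. \<exists>K. \<forall>\<^sub>F s in at x. h s = K" and top: "\<forall>\<^sub>F s in at_top. h s = L"
  shows "\<forall>\<^sub>F s in at x. h s = L"
proof -
  obtain H where H: "\<And>x. \<forall>\<^sub>F s in at x. h s = H x" using loc by metis
  have unique: "H x = K" if "\<forall>\<^sub>F s in at x. h s = K" for x K
    using eventually_happens[OF eventually_conj[OF H[of x] that]] by auto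
  have H_const: "\<forall>\<^sub>F y in at x. H x = H y" for x
  proof -
    obtain U where U: "open U" "x \<in> U" "\<And>s. s \<in> U \<Longrightarrow> s \<noteq> x \<Longrightarrow> h s = H x"
      using H[of x] unfolding eventually_at_topological by auto
    have "H y = H x" if "y \<in> U" "y \<noteq> x" for y
    proof (rule unique)
      have "open (U - {x})" using U by (intro open_Diff) auto
      then show "\<forall>\<^sub>F s in at y. h s = H x"
        unfolding eventually_at_topological using that U by (intro exI[of _ "U - {x}"]) auto
    qed
    then show ?thesis unfolding eventually_at_topological using U by metis
  qed
  obtain N where N: "\<And>s. s \<ge> N \<Longrightarrow> h s = L" using top by (auto simp: eventually_at_top_linorder)
  have "\<forall>\<^sub>F s in at (N + 1). h s = L"
    unfolding eventually_at_topological using N by (intro exI[of _ "{N<..}"]) auto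
  then have "H (N + 1) = L" by (rule unique)
  moreover have "H x = H (N + 1)"
    by (rule connected_local_const[OF connected_UNIV]) (use H_const in auto)
  ultimately show ?thesis using H[of x] by simp
qed

section \<open>Walls crossed when the cost of one position varies\<close>

context root_index
begin

context
  fixes c :: "nat \<times> nat \<Rightarrow> real" and x0 :: "nat \<times> nat" and M :: "nat \<times> nat \<Rightarrow> int"
  assumes gen: "generic n c" and x0: "x0 \<in> {..<n} \<times> {..<n}"
begin

definition red :: "real \<Rightarrow> basis \<Rightarrow> nat \<times> nat \<Rightarrow> real" where
  "red s B e = cost n c (dir B e) + s * of_int (dir B e x0)"

definition moved :: "real \<Rightarrow> basis \<Rightarrow> int" where
  "moved s B = contrib n (c(x0 := c x0 + s)) M B"

lemma moved_eq: "moved s B = (\<Prod>e\<in>nonbasic n B. geo_coeff (red s B e) (M e))"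
  using x0 by (simp add: moved_def contrib_def red_def cost_upd)

lemma cost_dir_neq_0: "B \<in> bases n l \<Longrightarrow> e \<in> nonbasic n B \<Longrightarrow> cost n c (dir B e) \<noteq> 0"
proof
  assume B: "B \<in> bases n l" and e: "e \<in> nonbasic n B" and "cost n c (dir B e) = 0"
  moreover have "\<bar>dir B e x\<bar> \<le> 18" for x using abs_dir_le[OF B, of e x] by simp
  moreover have "e \<in> {..<n} \<times> {..<n}" using e by (simp add: nonbasic_def)
  ultimately have "dir B e e = 0" using gen unfolding generic_def by blast
  then show False using dir_nonbasic[OF B e e] by simp
qed

text \<open>Two vanishing reduced costs can be combined so that \<open>s\<close> cancels. The
  combination \<open>D\<close> has cost 0 under \<open>c\<close> and entries of absolute value at
  most 18, so it is 0 on the square. Its entry at \<open>e\<close> is \<open>dir B f x0\<close>; if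
  that is 0, the reduced cost of \<open>f\<close> is constant in \<open>s\<close> and nonzero by
  genericity.\<close>

lemma red_zero_unique:
  assumes B: "B \<in> bases n l" and e: "e \<in> nonbasic n B" and f: "f \<in> nonbasic n B"
    and zero: "red s B e = 0" "red s B f = 0"
  shows "e = f"
proof (rule ccontr)
  assume neq: "e \<noteq> f"
  let ?a = "dir B e x0" and ?b = "dir B f x0"
  define D where "D = (\<lambda>x. ?b * dir B e x + (- ?a) * dir B f x)"
  have "cost n c D = of_int ?b * cost n c (dir B e) + of_int (- ?a) * cost n c (dir B f)"
    unfolding D_def by (rule cost_lincomb)
  moreover have "cost n c (dir B e) = - (s * of_int ?a)" "cost n c (dir B f) = - (s * of_int ?b)"
    using zero by (simp_all add: red_def)
  ultimately have "cost n c D = 0" by simp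
  moreover have "\<bar>D x\<bar> \<le> 18" for x
  proof -
    have "\<bar>D x\<bar> \<le> \<bar>?b * dir B e x\<bar> + \<bar>?a * dir B f x\<bar>"
      unfolding D_def by linarith
    also have "\<dots> \<le> 3 * 3 + 3 * 3"
      unfolding abs_mult using B by (intro add_mono mult_mono) (auto simp: abs_dir_le)
    finally show ?thesis by simp
  qed
  moreover have "e \<in> {..<n} \<times> {..<n}" using e by (simp add: nonbasic_def)
  ultimately have "D e = 0" using gen unfolding generic_def by blast
  then have "?b = 0" using neq by (simp add: D_def dir_nonbasic[OF B] e f)
  then show False using zero(2) cost_dir_neq_0[OF B f] by (simp add: red_def)
qed

lemma pivot_red:
  assumes "pivot n l B e B' f"
  shows "red s B' f = - red s B e"
    and "red s B e = 0 \<Longrightarrow> g \<in> nonbasic n B \<Longrightarrow> g \<noteq> e \<Longrightarrow> red s B' g = red s B g"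
proof -
  show "red s B' f = - red s B e"
    by (simp add: red_def pivot_dir[OF assms] cost_uminus)
  assume zero: "red s B e = 0" and g: "g \<in> nonbasic n B" "g \<noteq> e"
  have eq: "dir B' g = (\<lambda>x. 1 * dir B g x + dir B g f * dir B e x)"
    using pivot_dir_other[OF assms g] by auto
  have "red s B' g = red s B g + of_int (dir B g f) * red s B e"
    unfolding red_def eq cost_lincomb by (simp add: algebra_simps)
  then show "red s B' g = red s B g" using zero by simp
qed

lemma eventually_moved_regular:
  assumes "B \<in> bases n l" "\<And>e. e \<in> nonbasic n B \<Longrightarrow> red \<tau> B e \<noteq> 0"
  shows "\<forall>\<^sub>F s in at \<tau>. moved s B = moved \<tau> B"
proof -
  have "\<forall>\<^sub>F s in at \<tau>. \<forall>e\<in>nonbasic n B. geo_coeff (red s B e) (M e) = geo_coeff (red \<tau> B e) (M e)"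
    using assms unfolding red_def by (intro eventually_ball_finite ballI eventually_geo_coeff) auto
  then show ?thesis by (rule eventually_mono) (auto simp: moved_eq intro!: prod.cong)
qed

text \<open>At the other nonbasic positions the reduced costs of both bases agree at the wall and
  are nonzero there, so those factors are common and locally constant. What remains is the sum in
  \<open>geo_coeff_pair\<close>.\<close>

lemma eventually_moved_pivot:
  assumes piv: "pivot n l B e B' f" and zero: "red \<tau> B e = 0"
  shows "\<exists>K. \<forall>\<^sub>F s in at \<tau>. moved s B + moved s B' = K"
proof -
  have B: "B \<in> bases n l" "B' \<in> bases n l" "e \<in> nonbasic n B" "f \<notin> nonbasic n B"
    and nb: "nonbasic n B' = insert f (nonbasic n B - {e})"
    using piv by (auto simp: pivot_def nonbasic_def)
  define N where "N = nonbasic n B - {e}"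
  define Q where "Q = (\<Prod>g\<in>N. geo_coeff (red \<tau> B g) (M g))"
  have regular: "red \<tau> B g \<noteq> 0" "red \<tau> B' g = red \<tau> B g" if "g \<in> N" for g
    using red_zero_unique[OF B(1) B(3), of g \<tau>] pivot_red(2)[OF piv zero] zero that by (auto simp: N_def)
  have "\<forall>\<^sub>F s in at \<tau>. \<forall>g\<in>N. geo_coeff (red s B g) (M g) = geo_coeff (red \<tau> B g) (M g) \<and>
      geo_coeff (red s B' g) (M g) = geo_coeff (red \<tau> B g) (M g)"
  proof (intro eventually_ball_finite ballI eventually_conj)
    fix g assume g: "g \<in> N"
    show "\<forall>\<^sub>F s in at \<tau>. geo_coeff (red s B g) (M g) = geo_coeff (red \<tau> B g) (M g)"
      using regular[OF g] unfolding red_def by (intro eventually_geo_coeff)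
    show "\<forall>\<^sub>F s in at \<tau>. geo_coeff (red s B' g) (M g) = geo_coeff (red \<tau> B g) (M g)"
      unfolding regular(2)[OF g, symmetric] unfolding red_def
      using regular[OF g] unfolding red_def by (intro eventually_geo_coeff) simp
  qed (simp add: N_def)
  moreover have "\<forall>\<^sub>F s in at \<tau>. s \<noteq> \<tau>" by (rule eventually_neq_at_within)
  ultimately have "\<forall>\<^sub>F s in at \<tau>. moved s B + moved s B' = (of_bool (M e \<ge> 0) - of_bool (M f < 0)) * Q"
  proof eventually_elim
    case (elim s)
    have "dir B e x0 \<noteq> 0" using zero cost_dir_neq_0[OF B(1,3)] by (auto simp: red_def)
    then have "red s B e \<noteq> red \<tau> B e" using elim by (simp add: red_def)
    then have pair: "geo_coeff (red s B e) (M e) + geo_coeff (red s B' f) (M f) =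
        of_bool (M e \<ge> 0) - of_bool (M f < 0)"
      unfolding zero pivot_red(1)[OF piv] by (rule geo_coeff_pair)
    have "moved s B = geo_coeff (red s B e) (M e) * Q"
      using elim B(3) by (simp add: moved_eq Q_def N_def prod.remove[of _ e])
    moreover have "moved s B' = geo_coeff (red s B' f) (M f) * Q"
      using elim B(4) by (simp add: moved_eq Q_def nb N_def)
    ultimately show ?case unfolding pair[symmetric] by (simp add: algebra_simps)
  qed
  then show ?thesis by blast
qed

text \<open>Pivoting along the vanishing edge is a fixed-point free involution on the bases that are
  singular at a wall, and the two contributions of a pair have a locally constant sum.\<close>

lemma eventually_sum_moved: "\<exists>K. \<forall>\<^sub>F s in at \<tau>. (\<Sum>B\<in>bases n l. moved s B) = K"
proof -
  define S where "S = {B \<in> bases n l. \<exists>e\<in>nonbasic n B. red \<tau> B e = 0}"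
  have fin: "finite S" "finite (bases n l)" using finite_bases by (simp_all add: S_def)
  have "\<exists>B'. \<exists>e f. red \<tau> B e = 0 \<and> pivot n l B e B' f" if "B \<in> S" for B
    using that pivot_exists unfolding S_def by blast
  then obtain \<iota> where \<iota>: "\<And>B. B \<in> S \<Longrightarrow> \<exists>e f. red \<tau> B e = 0 \<and> pivot n l B e (\<iota> B) f" by metis
  have inv: "\<iota> B \<in> S \<and> \<iota> (\<iota> B) = B" if B: "B \<in> S" for B
  proof -
    obtain e f where ef: "red \<tau> B e = 0" "pivot n l B e (\<iota> B) f" using \<iota>[OF B] by blast
    have sym: "pivot n l (\<iota> B) f B e" by (rule pivot_sym[OF ef(2)])
    have zero: "red \<tau> (\<iota> B) f = 0" using pivot_red(1)[OF ef(2)] ef(1) by simp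
    have 1: "\<iota> B \<in> bases n l" "f \<in> nonbasic n (\<iota> B)" using sym by (auto simp: pivot_def)
    then have S: "\<iota> B \<in> S" using zero by (auto simp: S_def)
    obtain e' f' where ef': "red \<tau> (\<iota> B) e' = 0" "pivot n l (\<iota> B) e' (\<iota> (\<iota> B)) f'" using \<iota>[OF S] by blast
    have "e' = f"
      by (rule red_zero_unique[OF 1(1) _ 1(2) ef'(1) zero]) (use ef'(2) in \<open>simp add: pivot_def\<close>)
    then have "\<iota> (\<iota> B) = B" using pivot_unique(1) ef'(2) sym by blast
    then show ?thesis using S by blast
  qed
  have "\<exists>K. \<forall>\<^sub>F s in at \<tau>. moved s B + moved s (\<iota> B) = K" if "B \<in> S" for B
    using \<iota>[OF that] eventually_moved_pivot by blast
  then obtain K where "\<And>B. B \<in> S \<Longrightarrow> \<forall>\<^sub>F s in at \<tau>. moved s B + moved s (\<iota> B) = K B" by metis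
  then have "\<forall>\<^sub>F s in at \<tau>. \<forall>B\<in>S. moved s B + moved s (\<iota> B) = K B"
    using fin by (simp add: eventually_ball_finite)
  moreover have "\<forall>\<^sub>F s in at \<tau>. \<forall>B\<in>bases n l - S. moved s B = moved \<tau> B"
    using fin by (intro eventually_ball_finite ballI eventually_moved_regular) (auto simp: S_def)
  \<comment> \<open>Summing over all of \<open>S\<close> counts every pair twice, once from either
    member.\<close>
  ultimately have "\<forall>\<^sub>F s in at \<tau>. (\<Sum>B\<in>bases n l. moved s B) = sum K S div 2 + sum (moved \<tau>) (bases n l - S)"
  proof eventually_elim
    case (elim s)
    have "bij_betw \<iota> S S" by (rule bij_betw_byWitness[of _ \<iota>]) (use inv in auto)
    then have "sum (moved s) S = (\<Sum>B\<in>S. moved s (\<iota> B))" by (rule sum.reindex_bij_betw[symmetric])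
    then have "2 * sum (moved s) S = (\<Sum>B\<in>S. moved s B + moved s (\<iota> B))" by (simp add: sum.distrib)
    also have "\<dots> = sum K S" using elim by simp
    finally have "sum (moved s) S = sum K S div 2" by simp
    moreover have "(\<Sum>B\<in>bases n l. moved s B) = sum (moved s) (bases n l - S) + sum (moved s) S"
      using fin by (intro sum.subset_diff) (auto simp: S_def)
    moreover have "sum (moved s) (bases n l - S) = sum (moved \<tau>) (bases n l - S)"
      using elim by (intro sum.cong) auto
    ultimately show ?case by simp
  qed
  then show ?thesis by blast
qed

text \<open>If a negative entry becomes arbitrarily expensive, then every basis has a nonbasic position
  whose sign contradicts its reduced cost, by the expansion of that entry in the basis.\<close>

lemma eventually_moved_top:
  assumes M: "M \<in> lat n (\<lambda>_. t) (\<lambda>_. t)" and "t \<ge> 0" and neg: "M x0 < 0" and B: "B \<in> bases n l"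
  shows "\<forall>\<^sub>F s in at_top. moved s B = 0"
proof -
  have "\<exists>e\<in>nonbasic n B. M e * dir B e x0 < 0"
  proof (rule ccontr)
    assume "\<not> ?thesis"
    then have "(\<Sum>e\<in>nonbasic n B. M e * dir B e x0) \<ge> 0" by (intro sum_nonneg) auto
    moreover have "t * perm_pt n B x0 \<ge> 0"
      using \<open>t \<ge> 0\<close> by (cases B; cases x0) (simp add: perm_pt_def)
    ultimately show False using neg lat_expansion[OF B M, of x0] by linarith
  qed
  then obtain e where e: "e \<in> nonbasic n B" and opp: "M e * dir B e x0 < 0" by blast
  have "\<forall>\<^sub>F s in at_top. geo_coeff (red s B e) (M e) = 0"
  proof (cases "dir B e x0 > 0")
    case True
    then have "filterlim (\<lambda>s. cost n c (dir B e) + s * of_int (dir B e x0)) at_top at_top"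
      by (intro filterlim_tendsto_add_at_top[OF tendsto_const] filterlim_at_top_mult_tendsto_pos[OF tendsto_const]
          filterlim_ident) auto
    then have "\<forall>\<^sub>F s in at_top. 0 < cost n c (dir B e) + s * of_int (dir B e x0)"
      unfolding filterlim_at_top_dense by blast
    then show ?thesis
      by (rule eventually_mono) (use True opp in \<open>auto simp: red_def geo_coeff_def mult_less_0_iff\<close>)
  next
    case False
    then have b: "dir B e x0 < 0" "M e > 0" using opp by (auto simp: mult_less_0_iff)
    then have "filterlim (\<lambda>s. - cost n c (dir B e) + s * of_int (- dir B e x0)) at_top at_top"
      by (intro filterlim_tendsto_add_at_top[OF tendsto_const] filterlim_at_top_mult_tendsto_pos[OF tendsto_const]
          filterlim_ident) auto
    then have "\<forall>\<^sub>F s in at_top. 0 < - cost n c (dir B e) + s * of_int (- dir B e x0)"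
      unfolding filterlim_at_top_dense by blast
    then show ?thesis
      by (rule eventually_mono) (use b in \<open>auto simp: red_def geo_coeff_def\<close>)
  qed
  then show ?thesis
    by (rule eventually_mono) (use e in \<open>auto simp: moved_eq\<close>)
qed

text \<open>The count vanishes for large \<open>s\<close> and keeps its value across all walls. It
  can be evaluated at \<open>s = 0\<close> because genericity keeps the original costs off the
  walls.\<close>

lemma sum_contrib_negative:
  assumes "M \<in> lat n (\<lambda>_. t) (\<lambda>_. t)" "t \<ge> 0" "M x0 < 0"
  shows "(\<Sum>B\<in>bases n l. contrib n c M B) = 0"
proof -
  have "\<forall>\<^sub>F s in at_top. \<forall>B\<in>bases n l. moved s B = 0"
    using assms by (intro eventually_ball_finite finite_bases ballI eventually_moved_top)
  then have "\<forall>\<^sub>F s in at_top. (\<Sum>B\<in>bases n l. moved s B) = 0"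
    by (rule eventually_mono) simp
  then have "\<forall>\<^sub>F s in at 0. (\<Sum>B\<in>bases n l. moved s B) = 0"
    by (intro eventually_const_propagate[OF eventually_sum_moved])
  moreover have "\<forall>\<^sub>F s in at 0. \<forall>B\<in>bases n l. moved s B = moved 0 B"
    by (intro eventually_ball_finite finite_bases ballI eventually_moved_regular)
      (auto simp: red_def cost_dir_neq_0)
  ultimately have "\<exists>s. (\<Sum>B\<in>bases n l. moved s B) = 0 \<and> (\<forall>B\<in>bases n l. moved s B = moved 0 B)"
    using eventually_happens[OF eventually_conj] by force
  then have "(\<Sum>B\<in>bases n l. moved 0 B) = 0" by auto
  then show ?thesis by (simp add: moved_def)
qed

end

end

subsection \<open>A generic cost vector with a known optimal basis\<close>

text \<open>The powers are ordered so that the identity permutation is optimal and the shortest paths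
  from the root are the single edges: the entries of the root row are the cheapest, followed by
  the diagonal entries. Any base above 18 would make the costs generic.\<close>

definition rank :: "nat \<Rightarrow> nat \<Rightarrow> nat \<times> nat \<Rightarrow> nat" where
  "rank n l = (\<lambda>(i, k). if i = l then k else if i = k then n + i else 2 * n + n * i + k)"

definition pow_cost :: "nat \<Rightarrow> nat \<Rightarrow> nat \<times> nat \<Rightarrow> real" where
  "pow_cost n l x = 40 ^ rank n l x"

lemma inj_on_rank: "inj_on (rank n l) ({..<n} \<times> {..<n})"
proof (rule inj_onI)
  have row: "n * i + k < n * j" if "k < n" "i < j" for i j k
  proof -
    have "n * i + k < n * Suc i" using that by simp
    also have "\<dots> \<le> n * j" using that by (intro mult_left_mono) auto
    finally show ?thesis .
  qed
  fix x y assume x: "x \<in> {..<n} \<times> {..<n}" and y: "y \<in> {..<n} \<times> {..<n}" and eq: "rank n l x = rank n l y"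
  obtain i k j m where xy: "x = (i, k)" "y = (j, m)" by (cases x; cases y)
  have less: "i < n" "k < n" "j < n" "m < n" using x y by (auto simp: xy)
  have "i = j" if "n * i + k = n * j + m"
    using row[of k i j] row[of m j i] less that by (cases i j rule: linorder_cases) auto
  then show "x = y"
    using eq less by (auto simp: xy rank_def split: if_splits)
qed

text \<open>Signed digits below the base: at the least exponent with a nonzero digit, all other
  terms are divisible by the next power of \<open>K\<close>, so \<open>K\<close> divides that
  digit.\<close>

lemma power_sum_eq_0:
  fixes D :: "'a \<Rightarrow> int" and f :: "'a \<Rightarrow> nat"
  assumes "finite A" "inj_on f A" and small: "\<And>x. \<bar>D x\<bar> < K" and sum0: "(\<Sum>x\<in>A. K ^ f x * D x) = 0"
    and "x \<in> A"
  shows "D x = 0"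
proof (rule ccontr)
  assume "D x \<noteq> 0"
  then have ex: "\<exists>y. y \<in> A \<and> D y \<noteq> 0" using \<open>x \<in> A\<close> by blast
  define y where "y = arg_min f (\<lambda>y. y \<in> A \<and> D y \<noteq> 0)"
  have y: "y \<in> A" "D y \<noteq> 0" and min: "\<And>z. z \<in> A \<Longrightarrow> D z \<noteq> 0 \<Longrightarrow> f y \<le> f z"
    using arg_min_natI[of "\<lambda>y. y \<in> A \<and> D y \<noteq> 0" x f] arg_min_nat_le[of "\<lambda>y. y \<in> A \<and> D y \<noteq> 0" _ f]
      \<open>x \<in> A\<close> \<open>D x \<noteq> 0\<close> unfolding y_def by auto
  have "K > 0" using small[of x] by linarith
  have "K ^ Suc (f y) dvd K ^ f z * D z" if "z \<in> A - {y}" for z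
  proof (cases "D z = 0")
    case False
    then have "f y < f z" 
      using min[of z] that y assms(2) by (metis DiffD1 DiffD2 inj_onD insertCI le_neq_implies_less)
    then show ?thesis by (intro dvd_mult2 le_imp_power_dvd) auto
  qed simp
  then have "K ^ Suc (f y) dvd (\<Sum>z\<in>A - {y}. K ^ f z * D z)" by (rule dvd_sum)
  moreover have "(\<Sum>z\<in>A - {y}. K ^ f z * D z) = - (K ^ f y * D y)"
    using sum0 sum.remove[OF assms(1) y(1), of "\<lambda>z. K ^ f z * D z"] by simp
  ultimately have "K ^ f y * K dvd K ^ f y * D y" by simp
  then have "K dvd D y" using \<open>K > 0\<close> by (subst (asm) dvd_mult_cancel_left) simp
  then show False using small[of y] y zdvd_not_zless[of "\<bar>D y\<bar>" K] by simp
qed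

lemma generic_pow_cost: "generic n (pow_cost n l)"
  unfolding generic_def
proof (intro allI impI ballI, elim conjE)
  fix D :: "nat \<times> nat \<Rightarrow> int" and x
  assume D: "\<forall>x. \<bar>D x\<bar> \<le> 18" and zero: "cost n (pow_cost n l) D = 0" and x: "x \<in> {..<n} \<times> {..<n}"
  have "real_of_int (\<Sum>x\<in>{..<n} \<times> {..<n}. 40 ^ rank n l x * D x) = 0"
    using zero by (simp add: cost_def pow_cost_def)
  then have "(\<Sum>x\<in>{..<n} \<times> {..<n}. 40 ^ rank n l x * D x) = 0" by (simp only: of_int_eq_0_iff)
  moreover have "\<bar>D y\<bar> < 40" for y using D[rule_format, of y] by simp
  ultimately show "D x = 0"
    using power_sum_eq_0[OF _ inj_on_rank _ _ x, of D 40] by simp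
qed

section \<open>Existence and uniqueness of an optimal basis\<close>

context root_index
begin

definition optimal :: "(nat \<times> nat \<Rightarrow> real) \<Rightarrow> basis \<Rightarrow> bool" where
  "optimal c B \<longleftrightarrow> (\<forall>e\<in>nonbasic n B. cost n c (dir B e) > 0)"

text \<open>The points of two optimal bases have equal cost, since neither can be cheaper by
  \<open>gap\<close>. Then the terms of \<open>gap\<close> are nonnegative with sum 0, so the point
  of one basis vanishes wherever the other is nonbasic; as basic entries are positive, the nonbasic
  sets agree.\<close>

lemma optimal_unique:
  assumes B: "B \<in> bases n l" "B' \<in> bases n l" and opt: "optimal c B" "optimal c B'"
  shows "B = B'"
proof -
  have gap: "cost n c (pos_pt n C') - cost n c (pos_pt n C) =
      (\<Sum>e\<in>nonbasic n C. of_int (pos_pt n C' e) * cost n c (dir C e))"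
    if "C \<in> bases n l" "C' \<in> bases n l" for C C'
  proof -
    have lat0: "(\<lambda>x. pos_pt n C' x - pos_pt n C x) \<in> lat n (\<lambda>_. 0) (\<lambda>_. 0)"
      using lat_diff[OF pos_pt_lat[OF that(2)] pos_pt_lat[OF that(1)]] by simp
    have "pos_pt n C' x - pos_pt n C x = (\<Sum>e\<in>nonbasic n C. pos_pt n C' e * dir C e x)" for x
      using lat_expansion[OF that(1) lat0, of x] pos_pt_nonbasic[OF that(1)] by simp
    then have "(\<lambda>x. 1 * pos_pt n C' x + (-1) * pos_pt n C x) =
        (\<lambda>x. \<Sum>e\<in>nonbasic n C. pos_pt n C' e * dir C e x)"
      by (simp add: fun_eq_iff)
    then have "cost n c (\<lambda>x. 1 * pos_pt n C' x + (-1) * pos_pt n C x) =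
        (\<Sum>e\<in>nonbasic n C. of_int (pos_pt n C' e) * cost n c (dir C e))"
      by (simp only: cost_sum)
    then show ?thesis unfolding cost_lincomb by simp
  qed
  have nonneg: "0 \<le> of_int (pos_pt n C' e) * cost n c (dir C e)"
    if "C' \<in> bases n l" "optimal c C" "e \<in> nonbasic n C" for C C' e
    using that pos_pt_nonneg[OF that(1), of e] by (auto simp: optimal_def intro!: mult_nonneg_nonneg)
  have "0 \<le> cost n c (pos_pt n B') - cost n c (pos_pt n B)" 
    unfolding gap[OF B] using nonneg[OF B(2) opt(1)] by (intro sum_nonneg)
  moreover have "0 \<le> cost n c (pos_pt n B) - cost n c (pos_pt n B')" 
    unfolding gap[OF B(2,1)] using nonneg[OF B(1) opt(2)] by (intro sum_nonneg)
  ultimately have eq0: "cost n c (pos_pt n B') - cost n c (pos_pt n B) = 0"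
      "cost n c (pos_pt n B) - cost n c (pos_pt n B') = 0" by auto
  have sub: "nonbasic n C \<subseteq> nonbasic n C'"
    if C: "C \<in> bases n l" "C' \<in> bases n l" "optimal c C"
      and "cost n c (pos_pt n C') - cost n c (pos_pt n C) = 0" for C C'
  proof
    fix e assume e: "e \<in> nonbasic n C"
    have "(\<Sum>e\<in>nonbasic n C. of_int (pos_pt n C' e) * cost n c (dir C e)) = 0"
      using gap[OF C(1,2)] that(4) by simp
    then have "of_int (pos_pt n C' e) * cost n c (dir C e) = 0"
      using nonneg[OF C(2,3)] e by (subst (asm) sum_nonneg_eq_0_iff) auto
    moreover have "cost n c (dir C e) > 0" using C(3) e by (simp add: optimal_def)
    ultimately have "pos_pt n C' e = 0" by simp
    then have "e \<notin> basic n C'" using pos_pt_basic[OF C(2), of e] by auto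
    then show "e \<in> nonbasic n C'" using e by (simp add: nonbasic_def)
  qed
  show ?thesis using sub[OF B opt(1) eq0(1)] sub[OF B(2,1) opt(2) eq0(2)] by (intro bases_eqI B) auto
qed

definition star :: "nat \<Rightarrow> nat" where
  "star x = (if x < n then l else x)"

lemma star_mem: "(id, star) \<in> bases n l"
proof -
  have "\<exists>k. (star ^^ k) x = l" if "x < n" for x
    using that by (intro exI[of _ 1]) (simp add: star_def)
  moreover have "star l = l" "\<And>x. x < n \<Longrightarrow> star x < n" "\<And>x. n \<le> x \<Longrightarrow> star x = x"
    using root by (auto simp: star_def)
  ultimately show ?thesis by (simp add: bases_def parent_funs_def permutes_id)
qed

lemma anc_star: "x < n \<Longrightarrow> anc star j x \<longleftrightarrow> j = x \<or> j = l"
proof -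
  have "(star ^^ k) l = l" for k by (induction k) (use root in \<open>auto simp: star_def\<close>)
  then show "x < n \<Longrightarrow> anc star j x \<longleftrightarrow> j = x \<or> j = l"
    using anc_cases[of star j x] by (auto simp: star_def anc_def)
qed

lemma path_wt_star:
  assumes "v < n" "j < n"
  shows "path_wt star v (i, j) = of_bool (j = v) * (of_bool (i = l) - of_bool (i = v))"
  using assms by (cases "j = l"; cases "j = v") (simp_all add: path_wt_def anc_star star_def)

lemma dir_star:
  assumes "s < n" "m < n" "s \<noteq> l" "s \<noteq> m" "i < n" "k < n"
  shows "dir (id, star) (s, m) (i, k) =
    of_bool ((i, k) = (l, s)) - of_bool ((i, k) = (s, s)) - of_bool ((i, k) = (l, m)) + of_bool ((i, k) = (s, m))"
  using assms by (cases "k = s"; cases "k = m") (simp_all add: dir_def cycle_wt_def path_wt_star)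

lemma cost_of_bool:
  assumes "x \<in> {..<n} \<times> {..<n}"
  shows "(\<Sum>y\<in>{..<n} \<times> {..<n}. c y * of_bool (y = x)) = (c x :: real)"
proof -
  have "(\<Sum>y\<in>{..<n} \<times> {..<n}. c y * of_bool (y = x)) = (\<Sum>y\<in>{..<n} \<times> {..<n}. if y = x then c x else 0)"
    by (intro sum.cong) auto
  then show ?thesis using assms by simp
qed

lemma optimal_star: "optimal (pow_cost n l) (id, star)"
  unfolding optimal_def
proof
  fix e assume e: "e \<in> nonbasic n (id, star)"
  obtain s m where sm: "e = (s, m)" "s < n" "m < n" "s \<noteq> m" "s \<noteq> l"
    using e by (cases e) (auto simp: mem_nonbasic star_def)
  let ?c = "pow_cost n l" and ?A = "{..<n} \<times> {..<n}"
  have "cost n ?c (dir (id, star) e) = (\<Sum>y\<in>?A. ?c y * of_bool (y = (l, s)) - ?c y * of_bool (y = (s, s))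
      - ?c y * of_bool (y = (l, m)) + ?c y * of_bool (y = (s, m)))"
    unfolding cost_def
  proof (intro sum.cong refl)
    fix y assume "y \<in> ?A"
    then show "?c y * of_int (dir (id, star) e y) = ?c y * of_bool (y = (l, s)) - ?c y * of_bool (y = (s, s))
      - ?c y * of_bool (y = (l, m)) + ?c y * of_bool (y = (s, m))"
      using sm by (cases y) (simp add: dir_star algebra_simps del: prod.inject)
  qed
  also have "\<dots> = ?c (l, s) - ?c (s, s) - ?c (l, m) + ?c (s, m)"
    unfolding sum.distrib sum_subtractf using sm root by (simp add: cost_of_bool)
  also have "\<dots> > 0"
  proof -
    \<comment> \<open>The factor 2 lets the single entry \<open>(s, m)\<close> outweigh both
      negative ones, \<open>(s, s)\<close> and \<open>(l, m)\<close>.\<close>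
    have "2 * 40 ^ a \<le> (40 ^ b :: real)" if "a < b" for a b :: nat
    proof -
      have "2 * 40 ^ a \<le> (40 ^ Suc a :: real)" by simp
      also have "\<dots> \<le> 40 ^ b" using that by (intro power_increasing) auto
      finally show ?thesis .
    qed
    then have "2 * ?c (s, s) \<le> ?c (s, m)" "2 * ?c (l, m) \<le> ?c (s, m)"
      using sm by (simp_all add: pow_cost_def rank_def)
    moreover have "?c (l, s) > 0" by (simp add: pow_cost_def)
    ultimately show ?thesis by simp
  qed
  finally show "cost n ?c (dir (id, star) e) > 0" .
qed

lemma sum_contrib_nonneg:
  assumes "\<And>x. M x \<ge> 0"
  shows "(\<Sum>B\<in>bases n l. contrib n (pow_cost n l) M B) = 1"
proof -
  have "contrib n (pow_cost n l) M B = of_bool (optimal (pow_cost n l) B)" for B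
  proof -
    have "contrib n (pow_cost n l) M B = (\<Prod>e\<in>nonbasic n B. of_bool (cost n (pow_cost n l) (dir B e) > 0))"
      unfolding contrib_def using assms by (intro prod.cong) (auto simp: geo_coeff_def not_less)
    also have "\<dots> = of_bool (optimal (pow_cost n l) B)"
      by (auto simp: optimal_def prod_zero_iff intro!: prod.neutral)
    finally show ?thesis .
  qed
  then have "(\<Sum>B\<in>bases n l. contrib n (pow_cost n l) M B) =
      (\<Sum>B\<in>bases n l. of_bool (optimal (pow_cost n l) B))" by simp
  also have "\<dots> = (\<Sum>B\<in>bases n l. if B = (id, star) then 1 else 0)"
    by (intro sum.cong) (use optimal_unique optimal_star star_mem in auto)
  also have "\<dots> = 1" using star_mem finite_bases by simp
  finally show ?thesis .
qed

theorem sum_contrib: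
  assumes "M \<in> lat n (\<lambda>_. int t) (\<lambda>_. int t)"
  shows "(\<Sum>B\<in>bases n l. contrib n (pow_cost n l) M B) = of_bool (\<forall>x. M x \<ge> 0)"
proof (cases "\<forall>x. M x \<ge> 0")
  case True
  then show ?thesis using sum_contrib_nonneg[of M] by auto
next
  case False
  then obtain x where x: "M x < 0" by (auto simp: not_le)
  then have "fst x < n \<and> snd x < n"
    using lat_outside[OF assms, of "fst x" "snd x"] by (cases "fst x < n \<and> snd x < n") auto
  then have "x \<in> {..<n} \<times> {..<n}" by (simp add: mem_Times_iff)
  then show ?thesis using sum_contrib_negative[OF generic_pow_cost _ assms _ x] False by simp
qed

end

section \<open>Laurent monomials\<close>

definition zmon :: "nat \<Rightarrow> (nat \<times> nat \<Rightarrow> int) \<Rightarrow> 'a :: idom ratfun" where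
  "zmon n M = (\<Prod>x\<in>{..<n} \<times> {..<n}. zvar (fst x) (snd x) powi M x)"

lemma zvar_power:
  "zvar i j ^ a = (Fraction_Field.Fract (Poly_Mapping.single (Poly_Mapping.single (i, j) a) 1) 1 :: 'a :: idom ratfun)"
proof (induction a)
  case 0
  then show ?case by (simp add: One_fract_def single_zero)
next
  case (Suc a)
  then show ?case
    by (simp add: zvar_def mult_single flip: single_add)
qed

lemma prod_zvar_power:
  assumes "finite A"
  shows "(\<Prod>x\<in>A. zvar (fst x) (snd x) ^ a x) =
    (Fraction_Field.Fract (Poly_Mapping.single (\<Sum>x\<in>A. Poly_Mapping.single x (a x)) 1) 1 :: 'a :: idom ratfun)"
  using assms
proof (induction A rule: finite_induct)
  case empty
  then show ?case by (simp add: One_fract_def)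
next
  case (insert x A)
  then show ?case by (simp add: zvar_power mult_single)
qed

lemma prod_zvar_power_inject:
  assumes "finite A" "x \<in> A"
    and eq: "(\<Prod>x\<in>A. zvar (fst x) (snd x) ^ a x) = (\<Prod>x\<in>A. zvar (fst x) (snd x) ^ b x :: 'a :: idom ratfun)"
  shows "a x = b x"
proof -
  let ?S = "\<lambda>a. \<Sum>x\<in>A. Poly_Mapping.single x (a x)"
  have "Poly_Mapping.single (?S a) 1 = (Poly_Mapping.single (?S b) 1 :: _ \<Rightarrow>\<^sub>0 'a)"
    using eq by (simp add: prod_zvar_power[OF assms(1)] eq_fract)
  then have "Poly_Mapping.lookup (Poly_Mapping.single (?S a) 1 :: _ \<Rightarrow>\<^sub>0 'a) (?S a) =
      Poly_Mapping.lookup (Poly_Mapping.single (?S b) 1) (?S a)" by simp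
  then have "?S a = ?S b" by (auto simp: lookup_single when_def split: if_splits)
  moreover have "Poly_Mapping.lookup (?S a) x = a x" for a
    using assms(1,2) by (simp add: lookup_sum lookup_single when_def)
  ultimately show ?thesis by metis
qed

lemma zvar_neq_0 [simp]: "(zvar i j :: 'a :: idom ratfun) \<noteq> 0"
proof
  assume "(zvar i j :: 'a ratfun) = 0"
  then have "Poly_Mapping.single (Poly_Mapping.single (i, j) (Suc 0)) (1 :: 'a) = 0"
    by (simp add: zvar_def Zero_fract_def eq_fract)
  then show False by (metis lookup_single_eq lookup_zero zero_neq_one)
qed

lemma zmon_add: "zmon n (\<lambda>x. M x + N x) = zmon n M * zmon n N"
  by (simp add: zmon_def power_int_add prod.distrib)

text \<open>Negative exponents are moved to the other side, which leaves monomials of the polynomial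
  ring to compare. This keeps the denominators \<open>1 - z^W\<close> different from 0.\<close>

lemma zmon_eq_1_imp:
  assumes "(zmon n W :: 'a :: idom ratfun) = 1" "x \<in> {..<n} \<times> {..<n}"
  shows "W x = 0"
proof -
  let ?A = "{..<n} \<times> {..<n}"
  have split: "(z :: 'a ratfun) powi w = z ^ nat w / z ^ nat (- w)" for z w
    by (cases "w \<ge> 0") (simp_all add: power_int_def power_inverse divide_inverse)
  have "(\<Prod>x\<in>?A. zvar (fst x) (snd x) ^ nat (W x)) / (\<Prod>x\<in>?A. zvar (fst x) (snd x) ^ nat (- W x)) = (1 :: 'a ratfun)"
    using assms(1) unfolding zmon_def split prod_dividef .
  then have "(\<Prod>x\<in>?A. zvar (fst x) (snd x) ^ nat (W x)) = (\<Prod>x\<in>?A. zvar (fst x) (snd x) ^ nat (- W x) :: 'a ratfun)"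
    by (simp add: divide_eq_1_iff)
  then have "nat (W x) = nat (- W x)" using assms(2) by (intro prod_zvar_power_inject) auto
  then show ?thesis by linarith
qed

section \<open>Two-sided series\<close>

text \<open>Functions on the exponent lattice are formal series that extend in all directions. They
  form a module over the Laurent polynomials; \<open>shift_diff W\<close> is multiplication by \<open>1 - z\<^sup>W\<close>.\<close>

type_synonym series = "(nat \<times> nat \<Rightarrow> int) \<Rightarrow> int"

definition shift_diff :: "(nat \<times> nat \<Rightarrow> int) \<Rightarrow> series \<Rightarrow> series" where
  "shift_diff W \<psi> = (\<lambda>M. \<psi> M - \<psi> (\<lambda>x. M x - W x))"

definition shift_diffs :: "(nat \<times> nat \<Rightarrow> int) list \<Rightarrow> series \<Rightarrow> series" where
  "shift_diffs Ws = foldr shift_diff Ws"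

definition supp :: "series \<Rightarrow> (nat \<times> nat \<Rightarrow> int) set" where
  "supp \<psi> = {M. \<psi> M \<noteq> 0}"

definition series_sum :: "nat \<Rightarrow> series \<Rightarrow> 'a :: idom ratfun" where
  "series_sum n \<psi> = (\<Sum>M\<in>supp \<psi>. of_int (\<psi> M) * zmon n M)"

text \<open>A series is tied to a rational function by clearing denominators. The factors are
  nonzero in the field but may annihilate a series, so that different series, such as the two
  expansions of a geometric series, represent the same \<open>y\<close>.\<close>

definition represents :: "nat \<Rightarrow> series \<Rightarrow> 'a :: idom ratfun \<Rightarrow> bool" where
  "represents n \<psi> y \<longleftrightarrow> (\<exists>Ws. (\<forall>W\<in>set Ws. zmon n W \<noteq> (1 :: 'a ratfun)) \<and> finite (supp (shift_diffs Ws \<psi>)) \<and>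
     series_sum n (shift_diffs Ws \<psi>) = (\<Prod>W\<leftarrow>Ws. 1 - zmon n W) * y)"

lemma series_sum_superset:
  assumes "finite A" "supp \<psi> \<subseteq> A"
  shows "series_sum n \<psi> = (\<Sum>M\<in>A. of_int (\<psi> M) * zmon n M)"
  unfolding series_sum_def by (rule sum.mono_neutral_left) (use assms in \<open>auto simp: supp_def\<close>)

lemma supp_add: "supp (\<lambda>M. \<phi> M + \<psi> M) \<subseteq> supp \<phi> \<union> supp \<psi>"
  by (auto simp: supp_def)

lemma series_sum_add:
  assumes "finite (supp \<phi>)" "finite (supp \<psi>)"
  shows "series_sum n (\<lambda>M. \<phi> M + \<psi> M) = series_sum n \<phi> + series_sum n \<psi>"
proof -
  have fin: "finite (supp \<phi> \<union> supp \<psi>)" using assms by simp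
  show ?thesis
    unfolding series_sum_superset[OF fin supp_add] series_sum_superset[OF fin Un_upper1]
      series_sum_superset[OF fin Un_upper2]
    by (simp add: sum.distrib distrib_right)
qed

lemma supp_translate: "supp (\<lambda>M. \<psi> (\<lambda>x. M x - W x)) = (\<lambda>M x. M x + W x) ` supp \<psi>"
proof
  show "supp (\<lambda>M. \<psi> (\<lambda>x. M x - W x)) \<subseteq> (\<lambda>M x. M x + W x) ` supp \<psi>"
  proof
    fix M assume "M \<in> supp (\<lambda>M. \<psi> (\<lambda>x. M x - W x))"
    then show "M \<in> (\<lambda>M x. M x + W x) ` supp \<psi>"
      by (intro image_eqI[of _ _ "\<lambda>x. M x - W x"]) (auto simp: supp_def)
  qed
qed (auto simp: supp_def)

lemma supp_shift_diff: "supp (shift_diff W \<psi>) \<subseteq> supp \<psi> \<union> (\<lambda>M x. M x + W x) ` supp \<psi>"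
  unfolding supp_translate[symmetric] by (auto simp: supp_def shift_diff_def)

lemma series_sum_shift_diff:
  assumes "finite (supp \<psi>)"
  shows "series_sum n (shift_diff W \<psi>) = (1 - zmon n W) * series_sum n \<psi>"
proof -
  let ?A = "supp \<psi>" and ?T = "\<lambda>M x. M x + W x :: int"
  have fin: "finite (?A \<union> ?T ` ?A)" using assms by simp
  have "series_sum n (shift_diff W \<psi>) = (\<Sum>M\<in>?A \<union> ?T ` ?A. of_int (\<psi> M) * zmon n M)
      - (\<Sum>M\<in>?A \<union> ?T ` ?A. of_int (\<psi> (\<lambda>x. M x - W x)) * zmon n M)"
    unfolding series_sum_superset[OF fin supp_shift_diff]
    by (simp add: shift_diff_def left_diff_distrib sum_subtractf)
  also have "(\<Sum>M\<in>?A \<union> ?T ` ?A. of_int (\<psi> M) * zmon n M) = series_sum n \<psi>"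
    by (rule series_sum_superset[OF fin, symmetric]) simp
  also have "(\<Sum>M\<in>?A \<union> ?T ` ?A. of_int (\<psi> (\<lambda>x. M x - W x)) * zmon n M) =
      series_sum n (\<lambda>M. \<psi> (\<lambda>x. M x - W x))"
    by (rule series_sum_superset[OF fin, symmetric]) (simp add: supp_translate)
  also have "\<dots> = (\<Sum>M\<in>?A. of_int (\<psi> M) * zmon n (?T M))"
  proof -
    have "inj_on ?T ?A" by (auto simp: inj_on_def fun_eq_iff)
    then show ?thesis by (simp add: series_sum_def supp_translate sum.reindex)
  qed
  also have "\<dots> = zmon n W * series_sum n \<psi>"
    by (simp add: zmon_add series_sum_def sum_distrib_left algebra_simps)
  finally show ?thesis by (simp add: algebra_simps)
qed

lemma shift_diffs_Nil [simp]: "shift_diffs [] \<psi> = \<psi>"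
  and shift_diffs_Cons [simp]: "shift_diffs (W # Ws) \<psi> = shift_diff W (shift_diffs Ws \<psi>)"
  and shift_diffs_append: "shift_diffs (Vs @ Ws) \<psi> = shift_diffs Vs (shift_diffs Ws \<psi>)"
  by (simp_all add: shift_diffs_def)

lemma shift_diff_commute: "shift_diff V (shift_diff W \<psi>) = shift_diff W (shift_diff V \<psi>)"
  by (simp add: shift_diff_def algebra_simps)

lemma shift_diffs_shift_diff: "shift_diffs Ws (shift_diff V \<psi>) = shift_diff V (shift_diffs Ws \<psi>)"
  by (induction Ws) (simp_all add: shift_diff_commute)

lemma shift_diffs_commute: "shift_diffs Vs (shift_diffs Ws \<psi>) = shift_diffs Ws (shift_diffs Vs \<psi>)"
  by (induction Vs) (simp_all add: shift_diffs_shift_diff)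

lemma shift_diffs_add:
  "shift_diffs Ws (\<lambda>M. \<phi> M + \<psi> M) = (\<lambda>M. shift_diffs Ws \<phi> M + shift_diffs Ws \<psi> M)"
  by (induction Ws) (simp_all add: shift_diff_def algebra_simps)

lemma finite_supp_shift_diffs: "finite (supp \<psi>) \<Longrightarrow> finite (supp (shift_diffs Ws \<psi>))"
  by (induction Ws) (auto intro: finite_subset[OF supp_shift_diff])

lemma series_sum_shift_diffs:
  "finite (supp \<psi>) \<Longrightarrow> series_sum n (shift_diffs Ws \<psi>) = (\<Prod>W\<leftarrow>Ws. 1 - zmon n W) * series_sum n \<psi>"
  by (induction Ws) (simp_all add: series_sum_shift_diff finite_supp_shift_diffs mult.assoc)

text \<open>On finitely supported series \<open>shift_diffs\<close> is honest multiplication in the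
  field, and the nonzero product of the factors can be cancelled.\<close>

lemma represents_unique:
  assumes "represents n \<psi> y" "finite (supp \<psi>)"
  shows "y = series_sum n \<psi>"
proof -
  obtain Ws where Ws: "\<And>W. W \<in> set Ws \<Longrightarrow> zmon n W \<noteq> (1 :: 'a ratfun)"
    and eq: "series_sum n (shift_diffs Ws \<psi>) = (\<Prod>W\<leftarrow>Ws. 1 - zmon n W) * y"
    using assms(1) unfolding represents_def by blast
  have "(\<Prod>W\<leftarrow>Ws. 1 - zmon n W) \<noteq> (0 :: 'a ratfun)"
    using Ws by (auto simp: prod_list_zero_iff)
  then show ?thesis using eq unfolding series_sum_shift_diffs[OF assms(2)] by simp
qed

lemma represents_add:
  assumes "represents n \<phi> x" "represents n \<psi> y"
  shows "represents n (\<lambda>M. \<phi> M + \<psi> M) (x + y)"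
proof -
  obtain Vs Ws where Vs: "\<And>W. W \<in> set Vs \<Longrightarrow> zmon n W \<noteq> (1 :: 'a ratfun)" "finite (supp (shift_diffs Vs \<phi>))"
      "series_sum n (shift_diffs Vs \<phi>) = (\<Prod>W\<leftarrow>Vs. 1 - zmon n W) * x"
    and Ws: "\<And>W. W \<in> set Ws \<Longrightarrow> zmon n W \<noteq> (1 :: 'a ratfun)" "finite (supp (shift_diffs Ws \<psi>))"
      "series_sum n (shift_diffs Ws \<psi>) = (\<Prod>W\<leftarrow>Ws. 1 - zmon n W) * y"
    using assms unfolding represents_def by blast
  have eq: "shift_diffs (Vs @ Ws) (\<lambda>M. \<phi> M + \<psi> M) =
      (\<lambda>M. shift_diffs Ws (shift_diffs Vs \<phi>) M + shift_diffs Vs (shift_diffs Ws \<psi>) M)"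
    by (simp add: shift_diffs_add shift_diffs_append shift_diffs_commute[of Vs Ws])
  have fin: "finite (supp (shift_diffs Ws (shift_diffs Vs \<phi>)))" "finite (supp (shift_diffs Vs (shift_diffs Ws \<psi>)))"
    using Vs Ws by (simp_all add: finite_supp_shift_diffs)
  have "finite (supp (shift_diffs (Vs @ Ws) (\<lambda>M. \<phi> M + \<psi> M)))"
    unfolding eq using fin by (intro finite_subset[OF supp_add]) simp
  moreover have "series_sum n (shift_diffs (Vs @ Ws) (\<lambda>M. \<phi> M + \<psi> M)) =
      (\<Prod>W\<leftarrow>Vs @ Ws. 1 - zmon n W) * (x + y)"
    unfolding eq series_sum_add[OF fin] using Vs Ws by (simp add: series_sum_shift_diffs algebra_simps)
  ultimately show ?thesis
    unfolding represents_def using Vs(1) Ws(1) by (intro exI[of _ "Vs @ Ws"]) auto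
qed

lemma represents_sum:
  assumes "finite A" "\<And>a. a \<in> A \<Longrightarrow> represents n (\<psi> a) (y a)"
  shows "represents n (\<lambda>M. \<Sum>a\<in>A. \<psi> a M) (\<Sum>a\<in>A. y a)"
  using assms
proof (induction A rule: finite_induct)
  case empty
  then show ?case
    unfolding represents_def by (intro exI[of _ "[]"]) (simp add: supp_def series_sum_def)
next
  case (insert a A)
  then show ?case using represents_add[of n "\<psi> a" "y a"] by simp
qed

section \<open>The series of a basis and the identity of generating functions\<close>

context root_index
begin

definition cone_series :: "nat \<Rightarrow> basis \<Rightarrow> series" where
  "cone_series t B M = of_bool (M \<in> lat n (\<lambda>_. int t) (\<lambda>_. int t)) * contrib n (pow_cost n l) M B"

lemma lat_translate_iff:
  assumes "W \<in> lat n (\<lambda>_. 0) (\<lambda>_. 0)"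
  shows "(\<lambda>x. M x - W x) \<in> lat n r c \<longleftrightarrow> M \<in> lat n r c"
  using lat_diff[OF _ assms, of M r c] lat_add[OF _ assms, of "\<lambda>x. M x - W x" r c] by auto

text \<open>Either expansion of \<open>1 / (1 - w)\<close> becomes 1 when multiplied by
  \<open>1 - w\<close>.\<close>

lemma geo_coeff_diff: "geo_coeff r m - geo_coeff r (m - 1) = of_bool (m = 0)"
  by (auto simp: geo_coeff_def)

text \<open>The shift by \<open>dir B e\<close> changes \<open>M e\<close> by one and no other
  nonbasic entry, so exactly the factor of \<open>e\<close> collapses, by
  \<open>geo_coeff_diff\<close>, to the indicator of \<open>M e = 0\<close>.\<close>

lemma shift_diffs_cone_series:
  assumes B: "B \<in> bases n l" and es: "distinct es" "set es \<subseteq> nonbasic n B"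
  shows "shift_diffs (map (dir B) es) (cone_series t B) M =
    of_bool (M \<in> lat n (\<lambda>_. int t) (\<lambda>_. int t)) *
    (\<Prod>e\<in>nonbasic n B - set es. geo_coeff (cost n (pow_cost n l) (dir B e)) (M e)) *
    (\<Prod>e\<in>set es. of_bool (M e = 0))"
  using es
proof (induction es arbitrary: M)
  case Nil
  then show ?case by (simp add: cone_series_def contrib_def)
next
  case (Cons e es)
  let ?L = "lat n (\<lambda>_. int t) (\<lambda>_. int t)"
  let ?g = "\<lambda>M e. geo_coeff (cost n (pow_cost n l) (dir B e)) (M e)"
  let ?M' = "\<lambda>x. M x - dir B e x"
  let ?N = "nonbasic n B - set (e # es)"
  have e: "e \<in> nonbasic n B" "e \<notin> set es" using Cons.prems by auto
  have M': "?M' f = M f - of_bool (f = e)" if "f \<in> nonbasic n B" for f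
    using dir_nonbasic[OF B e(1) that] by simp
  have set: "nonbasic n B - set es = insert e ?N" using e by auto
  have IH: "shift_diffs (map (dir B) es) (cone_series t B) X = of_bool (X \<in> ?L) *
      (?g X e * (\<Prod>f\<in>?N. ?g X f)) * (\<Prod>f\<in>set es. of_bool (X f = 0))" for X
  proof -
    have "(\<Prod>f\<in>nonbasic n B - set es. ?g X f) = ?g X e * (\<Prod>f\<in>?N. ?g X f)"
      unfolding set by (rule prod.insert) auto
    then show ?thesis using Cons.IH[of X] Cons.prems by simp
  qed
  have P1: "(\<Prod>f\<in>?N. ?g ?M' f) = (\<Prod>f\<in>?N. ?g M f)"
    using M' by (intro prod.cong) auto
  have P2: "(\<Prod>f\<in>set es. of_bool (?M' f = 0)) = (\<Prod>f\<in>set es. of_bool (M f = 0) :: int)"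
    using M' Cons.prems e by (intro prod.cong refl) (auto simp: subset_iff)
  have "shift_diffs (map (dir B) (e # es)) (cone_series t B) M =
      of_bool (M \<in> ?L) * (?g M e * (\<Prod>f\<in>?N. ?g M f)) * (\<Prod>f\<in>set es. of_bool (M f = 0)) -
      of_bool (M \<in> ?L) * (?g ?M' e * (\<Prod>f\<in>?N. ?g M f)) * (\<Prod>f\<in>set es. of_bool (M f = 0))"
    unfolding list.map shift_diffs_Cons shift_diff_def IH P1 P2 lat_translate_iff[OF dir_lat[OF B e(1)]] ..
  also have "\<dots> = of_bool (M \<in> ?L) * (\<Prod>f\<in>?N. ?g M f) * ((?g M e - ?g ?M' e) * (\<Prod>f\<in>set es. of_bool (M f = 0)))"
    by (simp add: algebra_simps)
  also have "?g M e - ?g ?M' e = of_bool (M e = 0)"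
    using M'[OF e(1)] by (simp add: geo_coeff_diff)
  finally show ?case using e by simp
qed

text \<open>With all factors cleared, only the matrix with margins \<open>t\<close> and all nonbasic
  entries 0 remains, which is \<open>t\<close> times the permutation matrix.\<close>

lemma represents_cone_series:
  assumes B: "B \<in> bases n l"
  shows "represents n (cone_series t B)
    (zmon n (\<lambda>x. int t * perm_pt n B x) * (\<Prod>e\<in>nonbasic n B. 1 / (1 - zmon n (dir B e))) :: 'a :: idom ratfun)"
proof -
  obtain es where es: "distinct es" "set es = nonbasic n B"
    using finite_distinct_list[OF finite_nonbasic] by blast
  let ?P = "\<lambda>x. int t * perm_pt n B x"
  have P: "?P \<in> lat n (\<lambda>_. int t) (\<lambda>_. int t)" using lat_scale[OF perm_pt_lat[OF B], of "int t"] by simp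
  have "shift_diffs (map (dir B) es) (cone_series t B) = (\<lambda>M. of_bool (M = ?P))"
  proof
    fix M
    have "shift_diffs (map (dir B) es) (cone_series t B) M =
        of_bool (M \<in> lat n (\<lambda>_. int t) (\<lambda>_. int t) \<and> (\<forall>e\<in>nonbasic n B. M e = 0))"
      using shift_diffs_cone_series[OF B es(1), of t M] es by (auto intro: prod.neutral)
    also have "\<dots> = of_bool (M = ?P)"
      using lat_eqI[OF B _ P, of M] perm_pt_nonbasic[OF B] P by (intro arg_cong[of _ _ of_bool]) auto
    finally show "shift_diffs (map (dir B) es) (cone_series t B) M = of_bool (M = ?P)" .
  qed
  moreover have "supp (\<lambda>M. of_bool (M = ?P)) = {?P}" by (auto simp: supp_def)
  moreover have neq: "zmon n (dir B e) \<noteq> (1 :: 'a ratfun)" if "e \<in> nonbasic n B" for e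
    using zmon_eq_1_imp[of n "dir B e" e] dir_nonbasic[OF B that that] that by (auto simp: nonbasic_def)
  moreover have "(\<Prod>W\<leftarrow>map (dir B) es. 1 - zmon n W) = (\<Prod>e\<in>nonbasic n B. 1 - zmon n (dir B e) :: 'a ratfun)"
    using es by (simp add: o_def flip: prod.distinct_set_conv_list)
  moreover have "(\<Prod>e\<in>nonbasic n B. 1 - zmon n (dir B e)) * (\<Prod>e\<in>nonbasic n B. 1 / (1 - zmon n (dir B e))) = (1 :: 'a ratfun)"
    unfolding prod.distrib[symmetric] using neq by (intro prod.neutral) auto
  ultimately show ?thesis
    unfolding represents_def using es
    by (intro exI[of _ "map (dir B) es"]) (auto simp: series_sum_def algebra_simps)
qed

lemma finite_nonneg_lat: "finite {M \<in> lat n (\<lambda>_. int t) (\<lambda>_. int t). \<forall>x. M x \<ge> 0}" (is "finite ?F")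
proof -
  let ?A = "{..<n} \<times> {..<n}"
  have "?F \<subseteq> (\<lambda>f x. if x \<in> ?A then f x else 0) ` (?A \<rightarrow>\<^sub>E {0..int t})"
  proof
    fix M assume M: "M \<in> ?F"
    have "M (i, k) \<le> int t" if "i < n" "k < n" for i k
    proof -
      have "M (i, k) \<le> (\<Sum>k<n. M (i, k))" by (rule member_le_sum) (use M that in auto)
      also have "\<dots> = int t" using M that by (simp add: lat_def)
      finally show ?thesis .
    qed
    then have "restrict M ?A \<in> ?A \<rightarrow>\<^sub>E {0..int t}" using M by auto
    moreover have "M = (\<lambda>x. if x \<in> ?A then restrict M ?A x else 0)"
      using M by (auto simp: lat_def)
    ultimately show "M \<in> (\<lambda>f x. if x \<in> ?A then f x else 0) ` (?A \<rightarrow>\<^sub>E {0..int t})" by blast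
  qed
  then show ?thesis by (rule finite_subset) (simp add: finite_PiE)
qed

theorem sum_bases:
  "(\<Sum>M | M \<in> lat n (\<lambda>_. int t) (\<lambda>_. int t) \<and> (\<forall>x. M x \<ge> 0). zmon n M) =
    (\<Sum>B\<in>bases n l. zmon n (\<lambda>x. int t * perm_pt n B x) *
      (\<Prod>e\<in>nonbasic n B. 1 / (1 - zmon n (dir B e))) :: 'a :: idom ratfun)"
proof -
  let ?F = "{M \<in> lat n (\<lambda>_. int t) (\<lambda>_. int t). \<forall>x. M x \<ge> 0}"
  let ?\<psi> = "\<lambda>M. \<Sum>B\<in>bases n l. cone_series t B M"
  have \<psi>: "?\<psi> = (\<lambda>M. of_bool (M \<in> ?F))"
  proof
    fix M
    show "?\<psi> M = of_bool (M \<in> ?F)"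
      using sum_contrib[of M t]
      by (cases "M \<in> lat n (\<lambda>_. int t) (\<lambda>_. int t)") (simp_all add: cone_series_def)
  qed
  have supp: "supp ?\<psi> = ?F" unfolding \<psi> by (auto simp: supp_def)
  have "represents n ?\<psi> (\<Sum>B\<in>bases n l. zmon n (\<lambda>x. int t * perm_pt n B x) *
      (\<Prod>e\<in>nonbasic n B. 1 / (1 - zmon n (dir B e))) :: 'a ratfun)"
    by (intro represents_sum finite_bases represents_cone_series)
  then have "(\<Sum>B\<in>bases n l. zmon n (\<lambda>x. int t * perm_pt n B x) *
      (\<Prod>e\<in>nonbasic n B. 1 / (1 - zmon n (dir B e))) :: 'a ratfun) = series_sum n ?\<psi>"
    by (rule represents_unique) (use supp finite_nonneg_lat in simp)
  also have "\<dots> = (\<Sum>M\<in>?F. zmon n M)"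
    unfolding series_sum_def supp by (intro sum.cong) (simp_all add: \<psi>[THEN fun_cong])
  finally show ?thesis by simp
qed

end

section \<open>Arborescences as parent functions\<close>

text \<open>If two paths leave \<open>u\<close> towards different \<open>x\<close> and
  \<open>y\<close>, following one to \<open>v\<close> and the other back gives a walk from
  \<open>x\<close> to \<open>y\<close> that avoids \<open>u\<close>. Shortened to a path and closed
  up through \<open>u\<close>, it is a cycle of length at least 3.\<close>

lemma (in pair_sym_digraph) apath_unique:
  assumes acyclic: "\<And>c. cycle c \<Longrightarrow> length c < 3"
    and "apath u p v" "apath u q v"
  shows "p = q"
  using assms(2,3)
proof (induction p arbitrary: u q)
  case Nil
  then have "u = v" by (simp add: apath_Nil_iff)
  then show ?case using apath_nonempty_ends[OF Nil.prems(2)] by auto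
next
  case (Cons e p)
  have "u \<noteq> v" using apath_nonempty_ends[OF Cons.prems(1)] by simp
  then obtain e' q' where q: "q = e' # q'" using Cons.prems(2) by (cases q) (auto simp: apath_Nil_iff)
  obtain x y where e: "e = (u, x)" and e': "e' = (u, y)"
    using Cons.prems by (cases e; cases e') (auto simp: q apath_Cons_iff)
  have p: "apath x p v" "u \<notin> set (awalk_verts x p)" "(u, x) \<in> parcs G"
    using Cons.prems(1) by (auto simp: e apath_Cons_iff)
  have q': "apath y q' v" "u \<notin> set (awalk_verts y q')" "(u, y) \<in> parcs G"
    using Cons.prems(2) by (auto simp: q e' apath_Cons_iff)
  have "x = y"
  proof (rule ccontr)
    assume "x \<noteq> y"
    have walks: "awalk x p v" "awalk y q' v" using p q' by (auto simp: apath_def)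
    then have walk: "awalk x (p @ rev_path q') y" by (intro awalk_appendI) auto
    define r where "r = awalk_to_apath (p @ rev_path q')"
    have r: "apath x r y" unfolding r_def by (rule apath_awalk_to_apath[OF walk])
    then have "r \<noteq> []" using \<open>x \<noteq> y\<close> by (auto simp: apath_Nil_iff)
    have rev: "(b, a) \<in> set q'" if "(a, b) \<in> set (rev_path q')" for a b
      using that by (induction q') auto
    have avoid: "fst a \<noteq> u \<and> snd a \<noteq> u" if a: "a \<in> set r" for a
    proof -
      have "a \<in> set p \<or> a \<in> set (rev_path q')"
        using a awalk_to_apath_subset[OF walk] unfolding r_def by auto
      then have "a \<in> set p \<or> (snd a, fst a) \<in> set q'"
        using rev[of "fst a" "snd a"] by auto
      then show ?thesis
        using awalk_verts_arc1[of a p] awalk_verts_arc2[OF walks(1), of a] p(2)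
          awalk_verts_arc1[of "(snd a, fst a)" q'] awalk_verts_arc2[OF walks(2), of "(snd a, fst a)"] q'(2)
        by auto
    qed
    have r_walk: "awalk x r y" and r_dist: "distinct (awalk_verts x r)" using r by (auto simp: apath_def)
    have "u \<notin> set (awalk_verts x r)"
      using avoid set_awalk_verts_not_Nil[OF r_walk \<open>r \<noteq> []\<close>] by auto
    moreover have "awalk_verts x (r @ [(y, u)]) = awalk_verts x r @ [u]"
      using \<open>r \<noteq> []\<close> awlast_of_awalk[OF r_walk] by (simp add: awalk_verts_conv)
    moreover have "(y, u) \<in> parcs G" using q'(3) by (rule arcs_symmetric)
    moreover have "awalk u ((u, x) # r @ [(y, u)]) u"
      using p(3) r_walk calculation(3) awlast_of_awalk[OF r_walk]
      by (auto simp: awalk_simps dest: wellformed')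
    ultimately have "cycle ((u, x) # r @ [(y, u)])"
      unfolding cycle_def using r_dist by (intro exI[of _ u]) auto
    then have "length ((u, x) # r @ [(y, u)]) < 3" by (rule acyclic)
    then show False using \<open>r \<noteq> []\<close> by (cases r) auto
  qed
  then show ?case using Cons.IH[OF p(1)] q' by (simp add: q e e')
qed

definition tree_of :: "nat \<Rightarrow> nat \<Rightarrow> (nat \<Rightarrow> nat) \<Rightarrow> nat pair_pre_digraph" where
  "tree_of n l p = \<lparr>pverts = {0..<n}, parcs = {(p u, u) |u. u < n \<and> u \<noteq> l}\<rparr>"

lemma tree_of_simps [simp]:
  "pverts (tree_of n l p) = {0..<n}" "parcs (tree_of n l p) = {(p u, u) |u. u < n \<and> u \<noteq> l}"
  by (simp_all add: tree_of_def)

abbreviation sym_graph :: "nat pair_pre_digraph \<Rightarrow> nat pair_pre_digraph" where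
  "sym_graph T \<equiv> mk_symmetric (with_proj T)"

lemma parcs_sym_graph: "parcs (sym_graph T) = parcs T \<union> (parcs T)\<inverse>"
  by (auto simp: parcs_mk_symmetric)

lemma pair_sym_digraph_sym_graph: "pair_wf_digraph T \<Longrightarrow> pair_sym_digraph (sym_graph T)"
proof -
  assume "pair_wf_digraph T"
  then interpret T: pair_wf_digraph T .
  interpret S: pair_wf_digraph "sym_graph T" by (rule T.wellformed_mk_symmetric)
  show ?thesis by unfold_locales (rule symmetric_mk_symmetric)
qed

lemma apath_sym_graph:
  assumes "pre_digraph.apath (with_proj T) u q v"
  shows "pre_digraph.apath (with_proj (sym_graph T)) u q v"
  using assms
  by (auto simp: pre_digraph.apath_def pre_digraph.awalk_def cas_with_proj_eq awalk_verts_with_proj_eq parcs_sym_graph)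

lemma pcas_nth: "pcas u q v \<Longrightarrow> Suc i < length q \<Longrightarrow> snd (q ! i) = fst (q ! Suc i)"
proof (induction q arbitrary: u i)
  case (Cons e q)
  then show ?case by (cases i; cases q) auto
qed simp

lemma pcas_ends: "pcas u q v \<Longrightarrow> q \<noteq> [] \<Longrightarrow> fst (hd q) = u \<and> snd (last q) = v"
  by (induction q arbitrary: u) (auto split: if_splits)

section \<open>Paths and acyclicity in the tree of a parent function\<close>

context rooted
begin

lemma wf_tree_of: "pair_wf_digraph (tree_of n l p)"
  by unfold_locales (auto simp: parent_less)

sublocale T: pair_wf_digraph "tree_of n l p"
  by (rule wf_tree_of)

sublocale S: pair_sym_digraph "sym_graph (tree_of n l p)"
  by (rule pair_sym_digraph_sym_graph[OF wf_tree_of])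

text \<open>The induction needs the extra claim that the path meets only ancestors of
  \<open>v\<close>: a child is not an ancestor of its parent, so appending its edge keeps the path
  simple.\<close>

lemma tree_path_exists:
  assumes "v < n"
  shows "\<exists>q. T.apath l q v \<and> (\<forall>x\<in>set (pawalk_verts l q). anc p x v)"
  using assms
proof (induction rule: depth_induct)
  case base
  then show ?case using root by (intro exI[of _ "[]"]) (simp add: T.apath_Nil_iff)
next
  case (step x)
  then obtain q where q: "T.apath l q (p x)" "\<And>y. y \<in> set (pawalk_verts l q) \<Longrightarrow> anc p y (p x)" by blast
  have walk: "T.awalk l q (p x)" using q(1) by (simp add: T.apath_def)
  have last: "last (pawalk_verts l q) = p x" using walk by (elim T.awalkE')
  have "x \<notin> set (pawalk_verts l q)" using q(2) not_anc_parent[OF step.hyps] by blast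
  moreover have "x \<noteq> p x" using parent_neq[OF step.hyps] by simp
  ultimately have "T.apath l (q @ [(p x, x)]) x"
    using q(1) last step.hyps by (auto simp: T.apath_append_iff T.apath_simps)
  moreover have "set (pawalk_verts l (q @ [(p x, x)])) \<subseteq> insert x (set (pawalk_verts l q))"
    using calculation T.awalk_verts_append[of l q "[(p x, x)]" x] by (auto simp: T.apath_def)
  ultimately show ?case using q(2) anc_step by (intro exI[of _ "q @ [(p x, x)]"]) auto
qed

lemma tree_path_last:
  assumes "T.apath l (q @ [e]) v"
  shows "e = (p v, v) \<and> v < n \<and> v \<noteq> l \<and> T.apath l q (p v)"
proof -
  obtain a b where e: "e = (a, b)" by (cases e)
  have q: "T.apath l q (last (pawalk_verts l q))" and "T.apath (last (pawalk_verts l q)) [e] v"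
    using assms unfolding T.apath_append_iff by auto
  then have "(a, b) \<in> parcs (tree_of n l p) \<and> a = last (pawalk_verts l q) \<and> b = v"
    unfolding e T.apath_simps fst_conv snd_conv by blast
  then have arc: "(a, b) \<in> parcs (tree_of n l p)" and a: "a = last (pawalk_verts l q)" and b: "b = v" by blast+
  from arc have "a = p v \<and> v < n \<and> v \<noteq> l" unfolding b by auto
  then show ?thesis using q a[symmetric] unfolding e b by simp
qed

lemma tree_path_unique: "v < n \<Longrightarrow> T.apath l q v \<Longrightarrow> T.apath l r v \<Longrightarrow> q = r"
proof (induction v arbitrary: q r rule: depth_induct)
  case base
  then show ?case using T.apath_nonempty_ends by blast
next
  case (step x)
  have "q \<noteq> []" "r \<noteq> []" using step by (auto simp: T.apath_Nil_iff)
  then obtain q' e r' f where qr: "q = q' @ [e]" "r = r' @ [f]" by (metis append_butlast_last_id)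
  show ?case
    using tree_path_last[of q' e x] tree_path_last[of r' f x] step qr by auto
qed

lemma root_path_eq: "v < n \<Longrightarrow> T.apath l q v \<Longrightarrow> root_path (tree_of n l p) l v = q"
  unfolding root_path_def using tree_path_unique by (intro the_equality) auto

lemma root_path_root: "root_path (tree_of n l p) l l = []"
  using root by (intro root_path_eq) (auto simp: T.apath_Nil_iff)

lemma root_path_step:
  assumes "x < n" "x \<noteq> l"
  shows "root_path (tree_of n l p) l x = root_path (tree_of n l p) l (p x) @ [(p x, x)]"
proof -
  obtain q where q: "T.apath l q x" using tree_path_exists[OF assms(1)] by blast
  then have "q \<noteq> []" using assms by (auto simp: T.apath_Nil_iff)
  then obtain q' e where qe: "q = q' @ [e]" by (metis append_butlast_last_id)
  then show ?thesis
    using tree_path_last[of q' e x] q root_path_eq[OF assms(1) q] root_path_eq[of "p x" q'] parent_less[OF assms(1)]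
    by auto
qed

lemma root_path_apath:
  assumes "v < n"
  shows "T.apath l (root_path (tree_of n l p) l v) v"
  using tree_path_exists[OF assms] root_path_eq[OF assms] by auto

text \<open>Take a vertex of greatest depth on the cycle. Its two neighbours there are no deeper,
  hence both are its parent. As the vertices of a cycle are distinct, predecessor and successor sit
  at the same index, which needs length at most 2.\<close>

lemma tree_of_acyclic:
  assumes "S.cycle c"
  shows "length c < 3"
proof (rule ccontr)
  assume len: "\<not> length c < 3"
  obtain u where walk: "S.awalk u c u" and dist: "distinct (tl (pawalk_verts u c))" and ne: "c \<noteq> []"
    using assms unfolding S.cycle_def by blast
  have cas: "pcas u c u" and arcs: "set c \<subseteq> parcs (sym_graph (tree_of n l p))"
    using walk by (auto simp: S.awalk_def)
  have "pawalk_verts u c = fst (hd c) # map snd c"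
    using S.awalk_verts_conv'[of u c u] cas ne by simp
  then have dist: "distinct (map snd c)" using dist by simp
  define m where "m = length c"
  have m: "m \<ge> 3" using len by (simp add: m_def)
  define nxt where "nxt i = (if Suc i < m then Suc i else 0)" for i
  have nxt_less: "nxt i < m" if "i < m" for i using that by (auto simp: nxt_def)
  have link: "snd (c ! i) = fst (c ! nxt i)" if "i < m" for i
  proof (cases "Suc i < m")
    case True
    then show ?thesis using pcas_nth[OF cas, of i] by (simp add: nxt_def m_def)
  next
    case False
    then have "i = m - 1" using that by simp
    then show ?thesis
      using pcas_ends[OF cas ne] ne False by (simp add: nxt_def m_def last_conv_nth hd_conv_nth)
  qed
  have arc: "(a, b) \<in> set c \<Longrightarrow> depth p l b \<le> depth p l a \<Longrightarrow> b = p a" 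
            "(a, b) \<in> set c \<Longrightarrow> depth p l a \<le> depth p l b \<Longrightarrow> a = p b" for a b
    using arcs depth_parent by (force simp: parcs_sym_graph)+
  define D where "D = (\<lambda>i. depth p l (snd (c ! i)))"
  obtain i where i: "i < m" "\<And>j. j < m \<Longrightarrow> D j \<le> D i"
  proof -
    have "Max (D ` {..<m}) \<in> D ` {..<m}" using m by (intro Max_in) (auto simp: lessThan_empty_iff)
    then obtain i where "i < m" "D i = Max (D ` {..<m})" by auto
    then show ?thesis using that[of i] by simp
  qed
  \<comment> \<open>Arc \<open>i\<close> enters the deepest vertex \<open>a\<close>, arc
    \<open>j\<close> leaves it, and arc \<open>h\<close> ends where arc \<open>i\<close>
    begins.\<close>
  define a where "a = snd (c ! i)"
  define j where "j = nxt i"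
  have j: "j < m" using nxt_less i by (simp add: j_def)
  have "(a, snd (c ! j)) = c ! j" using link[OF i(1)] by (simp add: a_def j_def prod_eq_iff)
  then have out: "(a, snd (c ! j)) \<in> set c" using j by (simp add: m_def)
  have "snd (c ! j) = p a" using arc(1)[OF out] i(2)[OF j] by (simp add: D_def a_def)
  moreover
  define h where "h = (if i = 0 then m - 1 else i - 1)"
  have h: "h < m" "nxt h = i" using i m by (auto simp: h_def nxt_def)
  have "(snd (c ! h), a) = c ! i" using link[OF h(1)] h(2) by (simp add: a_def prod_eq_iff)
  then have inc: "(snd (c ! h), a) \<in> set c" using i by (simp add: m_def)
  have "snd (c ! h) = p a" using arc(2)[OF inc] i(2)[OF h(1)] by (simp add: D_def a_def)
  ultimately have "map snd c ! j = map snd c ! h" using h j by (simp add: m_def)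
  then have "j = h" using nth_eq_iff_index_eq[OF dist, of j h] h(1) j by (simp add: m_def)
  then show False using m i by (auto simp: h_def j_def nxt_def split: if_splits)
qed

lemma tree_of_mem: "tree_of n l p \<in> arborescences l n"
proof -
  let ?T = "tree_of n l p"
  have arcs: "parcs ?T \<subseteq> all_edges n"
    using parent_less parent_neq by (auto simp: all_edges_def)
  have "asym (parcs ?T)"
  proof (rule asymI)
    fix a b assume "(a, b) \<in> parcs ?T"
    then have b: "a = p b" "b < n" "b \<noteq> l" by auto
    show "(b, a) \<notin> parcs ?T"
    proof
      assume "(b, a) \<in> parcs ?T"
      then have "b = p a" by auto
      then have "anc p b a" using anc_parent[of p a] by simp
      then show False using not_anc_parent[OF b(2,3)] b(1) by simp
    qed
  qed
  moreover have "connected (with_proj ?T)"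
    unfolding connected_def strongly_connected_def
  proof (intro conjI ballI)
    show "verts (with_proj (sym_graph ?T)) \<noteq> {}" using root by simp
    fix a b assume "a \<in> verts (with_proj (sym_graph ?T))" "b \<in> verts (with_proj (sym_graph ?T))"
    then have ab: "a < n" "b < n" by auto
    have walk: "S.awalk l (root_path ?T l v) v" if "v < n" for v
      using apath_sym_graph[OF root_path_apath[OF that]] by (simp add: S.apath_def)
    have "S.awalk a (rev_path (root_path ?T l a) @ root_path ?T l b) b"
      using walk ab by (intro S.awalk_appendI) auto
    then show "a \<rightarrow>\<^sup>*\<^bsub>with_proj (sym_graph ?T)\<^esub> b" by (rule S.reachable_awalkI)
  qed
  moreover have "\<not> (\<exists>c. S.cycle c \<and> 3 \<le> length c)" using tree_of_acyclic by fastforce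
  ultimately have "directed_spanning_tree n ?T" using arcs by (simp add: directed_spanning_tree_def)
  moreover have "\<exists>q. S.apath l (q @ [(p u, u)]) u" if "u < n" "u \<noteq> l" for u
    using apath_sym_graph[OF root_path_apath[OF that(1)]] root_path_step[OF that] by auto
  ultimately show ?thesis by (auto simp: arborescences_def)
qed

end

text \<open>The path from the root to the head of an arc ends with that arc. As paths are unique,
  each vertex other than \<open>l\<close> is the head of exactly one arc, whose tail becomes the
  parent, and \<open>l\<close> is the head of none.\<close>

lemma arborescence_is_tree_of:
  assumes T: "T \<in> arborescences l n" and l: "l < n"
  shows "\<exists>p\<in>parent_funs n l. T = tree_of n l p"
proof -
  have verts: "pverts T = {0..<n}" and arcs: "parcs T \<subseteq> all_edges n" and conn: "connected (with_proj T)"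
    and acyc: "\<And>c. pre_digraph.cycle (with_proj (sym_graph T)) c \<Longrightarrow> length c < 3"
    using T unfolding arborescences_def directed_spanning_tree_def by (blast, blast, blast, auto simp: not_le)
  have orient: "\<exists>q. pre_digraph.apath (with_proj (sym_graph T)) l (q @ [(s, u)]) u"
    if "(s, u) \<in> parcs T" for s u
    using T that unfolding arborescences_def by blast
  have wf: "pair_wf_digraph T"
    by unfold_locales (use verts arcs in \<open>auto simp: all_edges_def\<close>)
  interpret S: pair_sym_digraph "sym_graph T" by (rule pair_sym_digraph_sym_graph[OF wf])
  have unique: "q = r" if "S.apath a q b" "S.apath a r b" for a b q r
    using S.apath_unique[OF acyc] that by blast
  have no_root: "u \<noteq> l" if "(s, u) \<in> parcs T" for s u
    using orient[OF that] S.apath_nonempty_ends by fastforce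
  have parent_unique: "s = s'" if "(s, u) \<in> parcs T" "(s', u) \<in> parcs T" for s s' u
    using orient[OF that(1)] orient[OF that(2)] unique by fastforce
  have path: "\<exists>r. S.apath l r u" if "u < n" for u
    using conn l that verts by (auto simp: connected_def strongly_connected_def S.reachable_apath)
  have parent_exists: "\<exists>s. (s, u) \<in> parcs T" if u: "u < n" "u \<noteq> l" for u
  proof -
    obtain r where r: "S.apath l r u" using path[OF u(1)] by blast
    then have "r \<noteq> []" using u by (auto simp: S.apath_Nil_iff)
    then obtain r' x y where r': "r = r' @ [(x, y)]" by (metis append_butlast_last_id surj_pair)
    have "S.apath (last (pawalk_verts l r')) [(x, y)] u" using r unfolding r' S.apath_append_iff by auto
    then have xu: "(x, u) \<in> parcs (sym_graph T)" "y = u" by (auto simp: S.apath_simps)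
    show ?thesis
    proof (cases "(x, u) \<in> parcs T")
      \<comment> \<open>If the last edge were traversed against its direction, the path to
        \<open>x\<close> would end with \<open>(u, x)\<close> and begin with the path
        \<open>r\<close> to \<open>u\<close>, which already visits \<open>x\<close>.\<close>
      case False
      then have "(u, x) \<in> parcs T" using xu by (auto simp: parcs_sym_graph)
      then obtain q where q: "S.apath l (q @ [(u, x)]) x" using orient by blast
      then have "S.apath l q (last (pawalk_verts l q))" "S.apath (last (pawalk_verts l q)) [(u, x)] x"
        and disj: "set (pawalk_verts l q) \<inter> {x} = {}"
        unfolding S.apath_append_iff by auto
      then have "S.apath l q u" by (auto simp: S.apath_simps)
      then have "q = r" using unique r by blast
      then have "x \<in> set (pawalk_verts l q)" by (simp add: r' S.awalk_verts_conv)
      then show ?thesis using disj by simp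
    qed blast
  qed
  define p where "p u = (if u < n \<and> u \<noteq> l then SOME s. (s, u) \<in> parcs T else u)" for u
  have p_arc: "(p u, u) \<in> parcs T" if "u < n" "u \<noteq> l" for u
    using someI_ex[OF parent_exists[OF that]] that by (simp add: p_def)
  have anc_path: "S.apath l r u \<Longrightarrow> u < n \<Longrightarrow> anc p l u" for r u
  proof (induction r arbitrary: u rule: rev_induct)
    case Nil
    then show ?case by (simp add: S.apath_Nil_iff)
  next
    case (snoc e r)
    have "u \<noteq> l" using snoc.prems S.apath_nonempty_ends by blast
    then have arc: "(p u, u) \<in> parcs T" using p_arc snoc.prems by blast
    then obtain q where q: "S.apath l (q @ [(p u, u)]) u" using orient by blast
    then have "r = q" using unique[OF snoc.prems(1) q] by simp
    moreover have "S.apath l q (p u)" using q unfolding S.apath_append_iff by (auto simp: S.apath_simps)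
    moreover have "p u < n" using arc arcs by (auto simp: all_edges_def)
    ultimately show ?case using snoc.IH anc_step by blast
  qed
  have less: "p u < n" if "u < n" for u
    using p_arc[of u] arcs that by (cases "u = l") (auto simp: all_edges_def p_def)
  have "p \<in> parent_funs n l"
  proof -
    have "\<exists>k. (p ^^ k) u = l" if "u < n" for u
      using anc_path path[OF that] that unfolding anc_def by blast
    moreover have "p l = l" "\<And>u. n \<le> u \<Longrightarrow> p u = u" by (simp_all add: p_def)
    ultimately show ?thesis using less by (simp add: parent_funs_def)
  qed
  moreover have "parcs T = {(p u, u) |u. u < n \<and> u \<noteq> l}"
  proof (intro equalityI subsetI)
    fix e assume e: "e \<in> parcs T"
    obtain s u where su: "e = (s, u)" by (cases e)
    have u: "u < n" "u \<noteq> l" using e arcs no_root unfolding su by (auto simp: all_edges_def)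
    then have "s = p u" using parent_unique p_arc e unfolding su by blast
    then show "e \<in> {(p u, u) |u. u < n \<and> u \<noteq> l}" using u su by auto
  qed (use p_arc in auto)
  then have "T = tree_of n l p" using verts by (simp add: tree_of_def)
  ultimately show ?thesis by blast
qed

lemma inj_on_tree_of: "inj_on (tree_of n l) (parent_funs n l)"
proof (rule inj_onI)
  fix p q assume p: "p \<in> parent_funs n l" and q: "q \<in> parent_funs n l" and eq: "tree_of n l p = tree_of n l q"
  show "p = q"
  proof
    fix u
    have "parcs (tree_of n l p) = parcs (tree_of n l q)" using eq by simp
    then show "p u = q u"
      using p q by (cases "u < n \<and> u \<noteq> l") (auto simp: parent_funs_def set_eq_iff)
  qed
qed

lemma bij_betw_tree_of:
  assumes "l < n"
  shows "bij_betw (tree_of n l) (parent_funs n l) (arborescences l n)"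
proof -
  have "tree_of n l p \<in> arborescences l n" if "p \<in> parent_funs n l" for p
    using rooted.tree_of_mem that assms by (simp add: rooted_def)
  then show ?thesis
    unfolding bij_betw_def using inj_on_tree_of arborescence_is_tree_of[OF _ assms] by blast
qed

section \<open>Translation to matrices\<close>

lemma edge_weight_carrier [simp]: "edge_weight n e \<in> carrier_mat n n"
  by (simp add: edge_weight_def)

lemma foldr_edge_weight_carrier [simp]:
  "foldr (\<lambda>e A. edge_weight n e + A) q (0\<^sub>m n n) \<in> carrier_mat n n"
  by (induction q) simp_all

text \<open>The weights are folded from the root end of the path, whereas the induction on the tree
  extends the path at the other end.\<close>

lemma foldr_edge_weight_append:
  assumes "i < n" "j < n"
  shows "foldr (\<lambda>e A. edge_weight n e + A) (q @ [e]) (0\<^sub>m n n) $$ (i, j) =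
    foldr (\<lambda>e A. edge_weight n e + A) q (0\<^sub>m n n) $$ (i, j) + edge_weight n e $$ (i, j)"
proof (induction q)
  case Nil
  then show ?case using assms edge_weight_carrier[of n e] by simp
next
  case (Cons a q)
  show ?case
    using Cons assms carrier_matD[OF foldr_edge_weight_carrier[of n q]]
      carrier_matD[OF foldr_edge_weight_carrier[of n "q @ [e]"]] by simp
qed

context rooted
begin

lemma vertex_weight_carrier [simp]: "vertex_weight n l T v \<in> carrier_mat n n"
  unfolding vertex_weight_def by simp

lemma vertex_weight_eq:
  assumes "v < n" "i < n" "j < n"
  shows "vertex_weight n l (tree_of n l p) v $$ (i, j) = path_wt p v (i, j)"
  using assms(1)
proof (induction rule: depth_induct)
  case base
  then show ?case using assms by (simp add: vertex_weight_def root_path_root)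
next
  case (step x)
  have "vertex_weight n l (tree_of n l p) x $$ (i, j) =
      vertex_weight n l (tree_of n l p) (p x) $$ (i, j) + edge_weight n (p x, x) $$ (i, j)"
    unfolding vertex_weight_def root_path_step[OF step.hyps] by (rule foldr_edge_weight_append) fact+
  also have "edge_weight n (p x, x) $$ (i, j) = of_bool (j = x) * (of_bool (i = p j) - of_bool (i = j))"
    using assms parent_neq[OF step.hyps] by (auto simp: edge_weight_def)
  finally show ?case using step by (simp add: path_wt_step)
qed

lemma cycle_weight_carrier [simp]: "cycle_weight n l T e \<in> carrier_mat n n"
  unfolding cycle_weight_def by simp

lemma cycle_weight_eq:
  assumes "s < n" "u < n" "s \<noteq> u" "i < n" "j < n"
  shows "cycle_weight n l (tree_of n l p) (s, u) $$ (i, j) = cycle_wt p (s, u) (i, j)"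
proof -
  have "edge_weight n (s, u) $$ (i, j) = of_bool (j = u) * (of_bool (i = s) - of_bool (i = j))"
    using assms by (auto simp: edge_weight_def)
  then show ?thesis
    using assms vertex_weight_carrier[of "tree_of n l p" s] vertex_weight_carrier[of "tree_of n l p" u]
      edge_weight_carrier[of n "(s, u)"]
    by (simp add: cycle_weight_def cycle_wt_def vertex_weight_eq del: vertex_weight_carrier edge_weight_carrier)
qed

end

lemma zmon_cong: "(\<And>i k. i < n \<Longrightarrow> k < n \<Longrightarrow> M (i, k) = N (i, k)) \<Longrightarrow> zmon n M = zmon n N"
  unfolding zmon_def by (intro prod.cong) auto

lemma zmonom_eq: "M \<in> carrier_mat n n \<Longrightarrow> zmonom M = zmon n (\<lambda>x. M $$ x)"
  by (auto simp: zmonom_def zmon_def prod.cartesian_product split_def)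

lemma mult_perm_mat:
  assumes C: "C \<in> carrier_mat n n" and \<sigma>: "\<sigma> permutes {..<n}" and "i < n" "k < n"
  shows "(C * perm_mat n \<sigma>) $$ (i, k) = C $$ (i, inv_into UNIV \<sigma> k)"
proof -
  let ?\<tau> = "inv_into UNIV \<sigma>"
  have \<tau>: "?\<tau> k < n" using permutes_less_iff[OF permutes_inv[OF \<sigma>]] \<open>k < n\<close> by simp
  have iff: "k = \<sigma> j \<longleftrightarrow> j = ?\<tau> k" for j using permutes_inverses[OF \<sigma>] by metis
  have "(C * perm_mat n \<sigma>) $$ (i, k) = (\<Sum>j<n. C $$ (i, j) * (if k = \<sigma> j then 1 else 0))"
    using assms by (simp add: perm_mat_def scalar_prod_def atLeast0LessThan)
  also have "\<dots> = (\<Sum>j<n. if j = ?\<tau> k then C $$ (i, ?\<tau> k) else 0)"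
    by (intro sum.cong) (auto simp: iff)
  finally show ?thesis using \<tau> by simp
qed

lemma perm_mat_eq:
  assumes "\<sigma> permutes {..<n}" "i < n" "k < n"
  shows "perm_mat n \<sigma> $$ (i, k) = perm_pt n (inv_into UNIV \<sigma>, p) (i, k)"
proof -
  have "k = \<sigma> i \<longleftrightarrow> i = inv_into UNIV \<sigma> k" using permutes_inverses[OF assms(1)] by metis
  then show ?thesis using assms by (simp add: perm_mat_def perm_pt_def)
qed

lemma mem_dilate_birkhoff:
  assumes "t > 0"
  shows "map_mat real_of_int M \<in> dilate t (birkhoff n) \<longleftrightarrow>
    M \<in> carrier_mat n n \<and> (\<forall>i<n. \<forall>j<n. 0 \<le> M $$ (i, j)) \<and>
    (\<forall>i<n. (\<Sum>j<n. M $$ (i, j)) = int t) \<and> (\<forall>j<n. (\<Sum>i<n. M $$ (i, j)) = int t)"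
    (is "_ \<longleftrightarrow> ?R")
proof
  assume "map_mat real_of_int M \<in> dilate t (birkhoff n)"
  then obtain A where A: "A \<in> birkhoff n" and eq: "map_mat real_of_int M = real t \<cdot>\<^sub>m A"
    by (auto simp: dilate_def)
  have A_carrier: "A \<in> carrier_mat n n" using A by (simp add: birkhoff_def)
  have "map_mat real_of_int M \<in> carrier_mat n n" unfolding eq using A_carrier by simp
  then have M: "M \<in> carrier_mat n n" by simp
  have entry: "real_of_int (M $$ (i, j)) = real t * A $$ (i, j)" if "i < n" "j < n" for i j
    using arg_cong[OF eq, of "\<lambda>X. X $$ (i, j)"] that M A_carrier by simp
  have "0 \<le> M $$ (i, j)" if "i < n" "j < n" for i j
  proof -
    have "0 \<le> real_of_int (M $$ (i, j))" using entry[OF that] A that by (simp add: birkhoff_def)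
    then show ?thesis by simp
  qed
  moreover have "(\<Sum>j<n. M $$ (i, j)) = int t" if "i < n" for i
  proof -
    have "real_of_int (\<Sum>j<n. M $$ (i, j)) = real t * (\<Sum>j<n. A $$ (i, j))"
      using that by (simp add: entry sum_distrib_left)
    then show ?thesis using A that by (simp add: birkhoff_def flip: of_int_sum)
  qed
  moreover have "(\<Sum>i<n. M $$ (i, j)) = int t" if "j < n" for j
  proof -
    have "real_of_int (\<Sum>i<n. M $$ (i, j)) = real t * (\<Sum>i<n. A $$ (i, j))"
      using that by (simp add: entry sum_distrib_left)
    then show ?thesis using A that by (simp add: birkhoff_def flip: of_int_sum)
  qed
  ultimately show ?R using M by blast
next
  assume R: ?R
  define A where "A = mat n n (\<lambda>(i, j). real_of_int (M $$ (i, j)) / real t)"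
  have "(\<Sum>j<n. real_of_int (M $$ (i, j)) / real t) = 1" if "i < n" for i
    unfolding sum_divide_distrib[symmetric] of_int_sum[symmetric] using R that assms by simp
  moreover have "(\<Sum>i<n. real_of_int (M $$ (i, j)) / real t) = 1" if "j < n" for j
    unfolding sum_divide_distrib[symmetric] of_int_sum[symmetric] using R that assms by simp
  ultimately have "A \<in> birkhoff n" using R by (simp add: birkhoff_def A_def)
  moreover have "map_mat real_of_int M = real t \<cdot>\<^sub>m A"
    using R assms by (intro eq_matI) (auto simp: A_def)
  ultimately show "map_mat real_of_int M \<in> dilate t (birkhoff n)" by (simp add: dilate_def)
qed

lemma genfun_dilate_birkhoff:
  assumes "t > 0"
  shows "(genfun (dilate t (birkhoff n)) :: 'a :: idom ratfun) =
    (\<Sum>M | M \<in> lat n (\<lambda>_. int t) (\<lambda>_. int t) \<and> (\<forall>x. M x \<ge> 0). zmon n M)"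
proof -
  let ?S = "{M :: int mat. map_mat real_of_int M \<in> dilate t (birkhoff n)}"
  let ?F = "{M. M \<in> lat n (\<lambda>_. int t) (\<lambda>_. int t) \<and> (\<forall>x. M x \<ge> 0)}"
  have S: "M \<in> ?S \<longleftrightarrow> M \<in> carrier_mat n n \<and> (\<forall>i<n. \<forall>j<n. 0 \<le> M $$ (i, j)) \<and>
    (\<forall>i<n. (\<Sum>j<n. M $$ (i, j)) = int t) \<and> (\<forall>j<n. (\<Sum>i<n. M $$ (i, j)) = int t)" for M
    using mem_dilate_birkhoff[OF assms] by simp
  show ?thesis
    unfolding genfun_def
  proof (rule sum.reindex_bij_witness[of _ "mat n n" "\<lambda>M (i, k). if i < n \<and> k < n then M $$ (i, k) else 0"])
    fix M assume M: "M \<in> ?S"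
    then have carrier: "M \<in> carrier_mat n n" using S by blast
    show "mat n n (\<lambda>(i, k). if i < n \<and> k < n then M $$ (i, k) else 0) = M"
      using carrier by (intro eq_matI) auto
    show "(\<lambda>(i, k). if i < n \<and> k < n then M $$ (i, k) else 0) \<in> ?F"
      using M unfolding S by (auto simp: lat_def)
    show "zmon n (\<lambda>(i, k). if i < n \<and> k < n then M $$ (i, k) else 0) = (zmonom M :: 'a ratfun)"
      unfolding zmonom_eq[OF carrier] by (rule zmon_cong) simp
  next
    fix N assume N: "N \<in> ?F"
    show "(\<lambda>(i, k). if i < n \<and> k < n then mat n n N $$ (i, k) else 0) = N"
      using N by (auto simp: lat_def fun_eq_iff)
    show "mat n n N \<in> ?S"
      unfolding S using N by (simp add: lat_def)
  qed
qed

lemma prod_nontree_edges: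
  assumes "rooted n l p" and \<sigma>: "\<sigma> permutes {..<n}"
  shows "(\<Prod>e\<in>all_edges n - parcs (tree_of n l p).
      1 / (1 - zmonom (cycle_weight n l (tree_of n l p) e * perm_mat n \<sigma>))) =
    (\<Prod>e\<in>nonbasic n (inv_into UNIV \<sigma>, p). 1 / (1 - zmon n (dir (inv_into UNIV \<sigma>, p) e)) :: 'a :: idom ratfun)"
proof -
  interpret rooted n l p by fact
  let ?\<tau> = "inv_into UNIV \<sigma>" and ?T = "tree_of n l p"
  have \<tau>: "?\<tau> permutes {..<n}" by (rule permutes_inv[OF \<sigma>])
  have inv: "?\<tau> (\<sigma> u) = u" "\<sigma> (?\<tau> u) = u" for u using permutes_inverses[OF \<sigma>] by auto
  have less: "\<sigma> u < n \<longleftrightarrow> u < n" "?\<tau> u < n \<longleftrightarrow> u < n" for u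
    using permutes_less_iff[OF \<sigma>] permutes_less_iff[OF \<tau>] by auto
  \<comment> \<open>For \<open>u = l\<close> the conditions \<open>s \<noteq> u\<close> and
    \<open>s \<noteq> p u\<close> coincide, matching the absence of tree edges into the
    root.\<close>
  have edge: "(s, u) \<in> all_edges n - parcs ?T \<longleftrightarrow> s < n \<and> u < n \<and> s \<noteq> u \<and> s \<noteq> p u" for s u
    by (cases "u = l") (auto simp: all_edges_def)
  show ?thesis
  proof (rule prod.reindex_bij_witness[of _ "\<lambda>(s, k). (s, ?\<tau> k)" "\<lambda>(s, u). (s, \<sigma> u)"])
    fix e assume e: "e \<in> all_edges n - parcs ?T"
    obtain s u where su: "e = (s, u)" by (cases e)
    have less_su: "s < n" "u < n" "s \<noteq> u" "s \<noteq> p u" using e edge unfolding su by auto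
    show "(case case e of (s, u) \<Rightarrow> (s, \<sigma> u) of (s, k) \<Rightarrow> (s, ?\<tau> k)) = e" by (simp add: su inv)
    show "(case e of (s, u) \<Rightarrow> (s, \<sigma> u)) \<in> nonbasic n (?\<tau>, p)"
      using less_su by (simp add: su mem_nonbasic inv less)
    have "zmonom (cycle_weight n l ?T (s, u) * perm_mat n \<sigma>) = (zmon n (dir (?\<tau>, p) (s, \<sigma> u)) :: 'a ratfun)"
    proof -
      have "cycle_weight n l ?T (s, u) * perm_mat n \<sigma> \<in> carrier_mat n n"
        by (intro mult_carrier_mat[of _ _ n]) (simp_all add: perm_mat_def)
      then have "zmonom (cycle_weight n l ?T (s, u) * perm_mat n \<sigma>) =
          (zmon n (\<lambda>x. (cycle_weight n l ?T (s, u) * perm_mat n \<sigma>) $$ x) :: 'a ratfun)"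
        by (rule zmonom_eq)
      also have "\<dots> = zmon n (dir (?\<tau>, p) (s, \<sigma> u))"
        by (rule zmon_cong)
          (use less_su in \<open>simp add: mult_perm_mat[OF cycle_weight_carrier \<sigma>] cycle_weight_eq less dir_def inv\<close>)
      finally show ?thesis .
    qed
    then show "1 / (1 - zmon n (dir (?\<tau>, p) (case e of (s, u) \<Rightarrow> (s, \<sigma> u)))) =
        (1 / (1 - zmonom (cycle_weight n l ?T e * perm_mat n \<sigma>)) :: 'a ratfun)"
      by (simp add: su)
  next
    fix e assume e: "e \<in> nonbasic n (?\<tau>, p)"
    obtain s k where sk: "e = (s, k)" by (cases e)
    have "(s, ?\<tau> k) \<in> all_edges n - parcs ?T"
      unfolding edge using e less by (simp add: sk mem_nonbasic)
    then show "(case e of (s, k) \<Rightarrow> (s, ?\<tau> k)) \<in> all_edges n - parcs ?T" by (simp add: sk)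
    show "(case case e of (s, k) \<Rightarrow> (s, ?\<tau> k) of (s, u) \<Rightarrow> (s, \<sigma> u)) = e" by (simp add: sk inv)
  qed
qed

lemma zmonom_perm_mat:
  assumes "\<sigma> permutes {..<n}"
  shows "zmonom (int t \<cdot>\<^sub>m perm_mat n \<sigma>) = zmon n (\<lambda>x. int t * perm_pt n (inv_into UNIV \<sigma>, p) x)"
proof -
  have carrier: "perm_mat n \<sigma> \<in> carrier_mat n n" by (simp add: perm_mat_def)
  then show ?thesis
    by (subst zmonom_eq[of _ n]) (auto intro!: zmon_cong simp: perm_mat_eq[OF assms, of _ _ p])
qed

theorem theorem1p1:
  fixes n l t :: nat
  assumes "n \<ge> 2" and "l < n" and "t > 0"
  shows "(genfun (dilate t (birkhoff n)) :: ('a :: field_char_0) ratfun) =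
    (\<Sum>\<sigma> | \<sigma> permutes {0..<n}. \<Sum>T\<in>arborescences l n.
       zmonom (int t \<cdot>\<^sub>m perm_mat n \<sigma>) *
       (\<Prod>e \<in> all_edges n - parcs T. 1 / (1 - zmonom (cycle_weight n l T e * perm_mat n \<sigma>))))"
proof -
  interpret root_index n l by unfold_locales fact
  let ?F = "\<lambda>B. zmon n (\<lambda>x. int t * perm_pt n B x) *
      (\<Prod>e\<in>nonbasic n B. 1 / (1 - zmon n (dir B e))) :: 'a ratfun"
  let ?G = "\<lambda>\<sigma> T. zmonom (int t \<cdot>\<^sub>m perm_mat n \<sigma>) *
       (\<Prod>e \<in> all_edges n - parcs T. 1 / (1 - zmonom (cycle_weight n l T e * perm_mat n \<sigma>))) :: 'a ratfun"
  let ?inv = "inv_into UNIV :: (nat \<Rightarrow> nat) \<Rightarrow> nat \<Rightarrow> nat"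
  have term_eq: "?G \<sigma> (tree_of n l p) = ?F (?inv \<sigma>, p)"
    if "\<sigma> permutes {..<n}" "p \<in> parent_funs n l" for \<sigma> p
  proof -
    have "rooted n l p" using that assms by (simp add: rooted_def)
    then show ?thesis
      by (simp only: zmonom_perm_mat[OF that(1), of t p] prod_nontree_edges[OF _ that(1)])
  qed
  have "(\<Sum>T\<in>arborescences l n. ?G \<sigma> T) = (\<Sum>p\<in>parent_funs n l. ?F (?inv \<sigma>, p))"
    if "\<sigma> permutes {..<n}" for \<sigma>
    unfolding sum.reindex_bij_betw[OF bij_betw_tree_of[OF assms(2)], symmetric]
    by (intro sum.cong refl term_eq that)
  then have "(\<Sum>\<sigma> | \<sigma> permutes {0..<n}. \<Sum>T\<in>arborescences l n. ?G \<sigma> T) =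
      (\<Sum>\<sigma> | \<sigma> permutes {..<n}. \<Sum>p\<in>parent_funs n l. ?F (?inv \<sigma>, p))"
    unfolding atLeast0LessThan by (intro sum.cong refl) simp
  \<comment> \<open>Bases store \<open>\<tau>\<close>, the inverse of \<open>\<sigma>\<close>, so
    the sum is reindexed by inversion.\<close>
  also have "\<dots> = (\<Sum>\<tau> | \<tau> permutes {..<n}. \<Sum>p\<in>parent_funs n l. ?F (\<tau>, p))"
    by (rule sum.reindex_bij_witness[of _ ?inv ?inv]) (auto simp: permutes_inv permutes_inv_inv)
  also have "\<dots> = (\<Sum>B\<in>bases n l. ?F B)"
    by (simp add: bases_def sum.cartesian_product)
  also have "\<dots> = genfun (dilate t (birkhoff n))"
    unfolding genfun_dilate_birkhoff[OF assms(3)] by (rule sum_bases[symmetric])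
  finally show ?thesis by (rule sym)
qed

end
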